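(* The 2-form $\omega_{\mathcal M}=\frac1{4\pi i}(\omega_1+\omega_2)$, where $$\omega_1=\sum_{\ell=1}^N\mathrm{tr}\big(M_\ell^{-1}\mathrm dM_\ell\wedge K_\ell^{-1}\mathrm dK_\ell\big)+\sum_{\ell=1}^N\mathrm{tr}\big(\Lambda_\ell^{-1}C_\ell^{-1}\mathrm dC_\ell\wedge\Lambda_\ell C_\ell^{-1}\mathrm dC_\ell\big),\qquad \omega_2=2\sum_{\ell=1}^N\mathrm{tr}\big(\Lambda_\ell^{-1}\mathrm d\Lambda_\ell\wedge C_\ell^{-1}\mathrm dC_\ell\big),$$ with $\Lambda_\ell=e^{2\pi iL_\ell}$, $M_\ell=C_\ell\Lambda_\ell C_\ell^{-1}$, $K_\ell=M_1\cdots M_\ell$, is closed and non-degenerate on the monodromy manifold $$\mathcal M=\Big\{\{C_j,L_j\}_{j=1}^N:\ C_j\in SL(n,\mathbb C),\ L_j\in\mathfrak h_{ss}^{nr},\ \prod_{j=1}^NC_je^{2\pi iL_j}C_j^{-1}=\mathbf 1\Big\}\Big/\sim .$$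
   Context: $\mathfrak h_{ss}^{nr}$ is the set of traceless diagonal complex $n\times n$ matrices with pairwise distinct entries no two of which differ by an integer. The product is taken in increasing order of $j$. The equivalence $\sim$ is $C_j\mapsto SC_j$ with the same $S\in SL(n,\mathbb C)$ for all $j$; the form $\omega_{\mathcal M}$, written on the constraint set, is invariant under this action and descends to the quotient. *)

theory Defs
  imports "HOL-Analysis.Analysis"
begin

subsection \<open>Matrix preliminaries\<close>

definition msmult :: "complex \<Rightarrow> complex^'n^'n \<Rightarrow> complex^'n^'n" where
  "msmult c A = (\<chi> i j. c * A $ i $ j)"

definition mpow :: "complex^'n^'n \<Rightarrow> nat \<Rightarrow> complex^'n^'n" where
  "mpow A k = (((**) A) ^^ k) (mat 1)"

definition mexp :: "complex^'n^'n \<Rightarrow> complex^'n^'n" where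
  "mexp A = (\<Sum>k. (1 / fact k) *\<^sub>R mpow A k)"

definition diag_mat :: "complex^'n \<Rightarrow> complex^'n^'n" where
  "diag_mat l = (\<chi> i j. if i = j then l $ i else 0)"

definition mprod :: "(complex^'n^'n) list \<Rightarrow> complex^'n^'n" where
  "mprod As = foldr (**) As (mat 1)"

definition SL :: "(complex^'n^'n) set" where
  "SL = {S. det S = 1}"

definition sl :: "(complex^'n^'n) set" where
  "sl = {X. trace X = 0}"

definition h_ss_nr :: "(complex^'n^'n) set" where
  "h_ss_nr = {L. (\<forall>i j. i \<noteq> j \<longrightarrow> L $ i $ j = 0) \<and> trace L = 0 \<and>
     (\<forall>i j. i \<noteq> j \<longrightarrow> L $ i $ i \<noteq> L $ j $ j \<and> L $ i $ i - L $ j $ j \<notin> \<int>)}"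

subsection \<open>Monodromy data and the monodromy manifold\<close>

text \<open>
  The index set \<open>{1..N}\<close> is represented by a finite linearly ordered type \<open>'N\<close>; a point is a pair
  \<open>(C, l)\<close>, where \<open>l $ j\<close> is the vector of diagonal entries of the diagonal matrix \<open>L\<^sub>j\<close>.
\<close>

type_synonym ('n, 'N) mdata = "(((complex^'n)^'n)^'N) \<times> ((complex^'n)^'N)"

definition Cmat :: "'N \<Rightarrow> ('n::finite, 'N::finite) mdata \<Rightarrow> complex^'n^'n" where
  "Cmat j p = fst p $ j"

definition Lmat :: "'N \<Rightarrow> ('n::finite, 'N::finite) mdata \<Rightarrow> complex^'n^'n" where
  "Lmat j p = diag_mat (snd p $ j)"

definition Lam :: "'N \<Rightarrow> ('n::finite, 'N::finite) mdata \<Rightarrow> complex^'n^'n" where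
  "Lam j p = mexp (msmult (2 * of_real pi * \<i>) (Lmat j p))"

definition Mmat :: "'N \<Rightarrow> ('n::finite, 'N::finite) mdata \<Rightarrow> complex^'n^'n" where
  "Mmat j p = Cmat j p ** Lam j p ** matrix_inv (Cmat j p)"

definition Kmat :: "'N \<Rightarrow> ('n::finite, 'N::{finite,linorder}) mdata \<Rightarrow> complex^'n^'n" where
  "Kmat l p = mprod (map (\<lambda>j. Mmat j p) (sorted_list_of_set {..l}))"

definition total_monodromy :: "('n::finite, 'N::{finite,linorder}) mdata \<Rightarrow> complex^'n^'n" where
  "total_monodromy p = mprod (map (\<lambda>j. Mmat j p) (sorted_list_of_set UNIV))"

definition constraint_set :: "('n::finite, 'N::{finite,linorder}) mdata set" where
  "constraint_set =
     {p. (\<forall>j. Cmat j p \<in> SL) \<and> (\<forall>j. Lmat j p \<in> h_ss_nr) \<and> total_monodromy p = mat 1}"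

definition lmult :: "complex^'n^'n \<Rightarrow> ('n::finite, 'N::finite) mdata \<Rightarrow> ('n, 'N) mdata" where
  "lmult S p = ((\<chi> j. S ** fst p $ j), snd p)"

definition gauge_rel :: "(('n::finite, 'N::{finite,linorder}) mdata \<times> ('n, 'N) mdata) set" where
  "gauge_rel = {(p, q). p \<in> constraint_set \<and> q \<in> constraint_set \<and> (\<exists>S\<in>SL. q = lmult S p)}"

definition monodromy_manifold :: "('n::finite, 'N::{finite,linorder}) mdata set set" where
  "monodromy_manifold = constraint_set // gauge_rel"

subsection \<open>The form on the constraint set\<close>

abbreviation differential ::
    "('a::real_normed_vector \<Rightarrow> 'b::real_normed_vector) \<Rightarrow> 'a \<Rightarrow> 'a \<Rightarrow> 'b" where
  "differential F p v \<equiv> frechet_derivative F (at p) v"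

text \<open>The matrix-valued 1-form \<open>F\<inverse> dF\<close>.\<close>

definition log_diff ::
    "('a::real_normed_vector \<Rightarrow> complex^'n^'n) \<Rightarrow> 'a \<Rightarrow> 'a \<Rightarrow> complex^'n^'n" where
  "log_diff F p v = matrix_inv (F p) ** differential F p v"

text \<open>
  \<open>tr(\<alpha> \<and> \<beta>)\<close> for matrix-valued 1-forms at a point, with the convention
  \<open>(\<alpha> \<and> \<beta>)(v, w) = \<alpha>(v) \<beta>(w) - \<alpha>(w) \<beta>(v)\<close>.
\<close>

definition tr_wedge ::
    "('a \<Rightarrow> complex^'n^'n) \<Rightarrow> ('a \<Rightarrow> complex^'n^'n) \<Rightarrow> 'a \<Rightarrow> 'a \<Rightarrow> complex" where
  "tr_wedge \<alpha> \<beta> v w = trace (\<alpha> v ** \<beta> w) - trace (\<alpha> w ** \<beta> v)"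

definition omega1 :: "('n::finite, 'N::{finite,linorder}) mdata \<Rightarrow> ('n, 'N) mdata
    \<Rightarrow> ('n, 'N) mdata \<Rightarrow> complex" where
  "omega1 p v w =
     (\<Sum>l\<in>UNIV. tr_wedge (log_diff (Mmat l) p) (log_diff (Kmat l) p) v w) +
     (\<Sum>l\<in>UNIV. tr_wedge (\<lambda>v. matrix_inv (Lam l p) ** log_diff (Cmat l) p v)
                          (\<lambda>v. Lam l p ** log_diff (Cmat l) p v) v w)"

definition omega2 :: "('n::finite, 'N::{finite,linorder}) mdata \<Rightarrow> ('n, 'N) mdata
    \<Rightarrow> ('n, 'N) mdata \<Rightarrow> complex" where
  "omega2 p v w = 2 * (\<Sum>l\<in>UNIV. tr_wedge (log_diff (Lam l) p) (log_diff (Cmat l) p) v w)"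

definition omega :: "('n::finite, 'N::{finite,linorder}) mdata \<Rightarrow> ('n, 'N) mdata
    \<Rightarrow> ('n, 'N) mdata \<Rightarrow> complex" where
  "omega p v w = 1 / (4 * of_real pi * \<i>) * (omega1 p v w + omega2 p v w)"

subsection \<open>Tangent vectors of the quotient\<close>

text \<open>
  The constraint set is a regular level set: the product map is a submersion because
  \<open>(C, L) \<mapsto> C e\<^bsup>2\<pi>iL\<^esup> C\<inverse>\<close> is one from \<open>SL(n) \<times> h_ss_nr\<close> to \<open>SL(n)\<close>.
  Its tangent space is therefore the kernel of the differential of the product map
  on \<open>T(SL(n)) = C sl(n)\<close> times the traceless diagonal matrices.
\<close>

definition constraint_tangent ::
    "('n::finite, 'N::{finite,linorder}) mdata \<Rightarrow> ('n, 'N) mdata set" where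
  "constraint_tangent p =
     {v. (\<forall>j. log_diff (Cmat j) p v \<in> sl) \<and> (\<forall>j. trace (Lmat j v) = 0) \<and>
         differential total_monodromy p v = 0}"

text \<open>
  The tangent bundle of the quotient by the free \<open>SL(n)\<close>-action is the quotient of the tangent
  bundle of the constraint set by the tangent group: \<open>(p, v)\<close> is identified with
  \<open>(S p, S v + X S p)\<close> for \<open>S\<close> in \<open>SL(n)\<close> and \<open>X\<close> in \<open>sl(n)\<close>, where \<open>X\<close> acts by
  \<open>(C\<^sub>j, L\<^sub>j) \<mapsto> (X C\<^sub>j, 0)\<close>. The class of \<open>(p, v)\<close> is the image of \<open>v\<close> under the
  differential at \<open>p\<close> of the quotient map.
\<close>

type_synonym ('n, 'N) mtangent = "(('n, 'N) mdata \<times> ('n, 'N) mdata) set"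

definition inf_action ::
    "complex^'n^'n \<Rightarrow> ('n::finite, 'N::finite) mdata \<Rightarrow> ('n, 'N) mdata" where
  "inf_action X p = ((\<chi> j. X ** fst p $ j), 0)"

definition dproj ::
    "('n::finite, 'N::finite) mdata \<Rightarrow> ('n, 'N) mdata \<Rightarrow> ('n, 'N) mtangent" where
  "dproj p v =
     {(lmult S p, lmult S v + inf_action X (lmult S p)) | S X. S \<in> SL \<and> X \<in> sl}"

definition tangent_space ::
    "('n::finite, 'N::{finite,linorder}) mdata set \<Rightarrow> ('n, 'N) mtangent set" where
  "tangent_space x = {dproj p v | p v. p \<in> x \<and> v \<in> constraint_tangent p}"

subsection \<open>Two-forms on the quotient\<close>

type_synonym ('n, 'N) mform = "('n, 'N) mtangent \<Rightarrow> ('n, 'N) mtangent \<Rightarrow> complex"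

text \<open>\<open>\<Omega>\<close> pulls back to \<open>\<eta>\<close> under the projection from the constraint set.\<close>

definition descends_to :: "(('n::finite, 'N::{finite,linorder}) mdata \<Rightarrow> ('n, 'N) mdata
    \<Rightarrow> ('n, 'N) mdata \<Rightarrow> complex) \<Rightarrow> ('n, 'N) mform \<Rightarrow> bool" where
  "descends_to \<eta> \<Omega> \<longleftrightarrow>
     (\<forall>p\<in>constraint_set. \<forall>v\<in>constraint_tangent p. \<forall>w\<in>constraint_tangent p.
        \<Omega> (dproj p v) (dproj p w) = \<eta> p v w)"

definition omega_M :: "('n::finite, 'N::{finite,linorder}) mform" where
  "omega_M \<xi> \<zeta> = (THE c. \<exists>p\<in>constraint_set. \<exists>v\<in>constraint_tangent p. \<exists>w\<in>constraint_tangent p.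
     \<xi> = dproj p v \<and> \<zeta> = dproj p w \<and> c = omega p v w)"

definition nondegenerate_form :: "('n::finite, 'N::{finite,linorder}) mform \<Rightarrow> bool" where
  "nondegenerate_form \<Omega> \<longleftrightarrow>
     (\<forall>x\<in>monodromy_manifold. \<forall>\<xi>\<in>tangent_space x.
        (\<forall>\<zeta>\<in>tangent_space x. \<Omega> \<xi> \<zeta> = 0) \<longrightarrow> (\<exists>p\<in>x. \<xi> = dproj p 0))"

definition cscale :: "complex \<Rightarrow> ('n::finite, 'N::finite) mdata \<Rightarrow> ('n, 'N) mdata" where
  "cscale c v = ((\<chi> j. msmult c (fst v $ j)), (\<chi> j. c *s snd v $ j))"

text \<open>
  Complex differentiability on an open subset of \<open>\<complex>\<^sup>d\<close> already implies smoothness; we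
  ask for complex derivatives of all orders, so that the notion does not rest on that theorem.
\<close>

primrec complex_Ck_on :: "nat \<Rightarrow> (complex^'d) set
    \<Rightarrow> (complex^'d \<Rightarrow> ('n::finite, 'N::finite) mdata) \<Rightarrow> bool" where
  "complex_Ck_on 0 U f \<longleftrightarrow> continuous_on U f"
| "complex_Ck_on (Suc k) U f \<longleftrightarrow>
     (\<forall>u\<in>U. f differentiable (at u) \<and>
        (\<forall>c a. differential f u (c *s a) = cscale c (differential f u a))) \<and>
     (\<forall>a. complex_Ck_on k U (\<lambda>u. differential f u a))"

definition holomorphic_map_on :: "(complex^'d) set
    \<Rightarrow> (complex^'d \<Rightarrow> ('n::finite, 'N::finite) mdata) \<Rightarrow> bool" where
  "holomorphic_map_on U f \<longleftrightarrow> (\<forall>k. complex_Ck_on k U f)"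

text \<open>
  A local holomorphic chart of the quotient is represented by its inverse
  \<open>\<phi> : U \<rightarrow> \<M>\<close>, \<open>U \<subseteq> \<complex>\<^sup>d\<close> open, given through a holomorphic lift
  \<open>\<sigma>\<close> to the constraint set. It has to be injective with bijective differential at every
  point, which forces \<open>d\<close> to be the dimension of \<open>\<M>\<close> and makes \<open>\<phi>\<close> biholomorphic onto
  an open subset.
\<close>

definition chart_diff :: "(complex^'d \<Rightarrow> ('n::finite, 'N::finite) mdata)
    \<Rightarrow> complex^'d \<Rightarrow> complex^'d \<Rightarrow> ('n, 'N) mtangent" where
  "chart_diff \<sigma> u a = dproj (\<sigma> u) (differential \<sigma> u a)"

definition quotient_chart :: "(complex^'d) set
    \<Rightarrow> (complex^'d \<Rightarrow> ('n::finite, 'N::{finite,linorder}) mdata) \<Rightarrow> bool" where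
  "quotient_chart U \<sigma> \<longleftrightarrow>
     open U \<and> holomorphic_map_on U \<sigma> \<and> \<sigma> ` U \<subseteq> constraint_set \<and>
     inj_on (\<lambda>u. gauge_rel `` {\<sigma> u}) U \<and>
     (\<forall>u\<in>U. bij_betw (chart_diff \<sigma> u) UNIV (tangent_space (gauge_rel `` {\<sigma> u})))"

definition chart_pullback :: "('n::finite, 'N::finite) mform \<Rightarrow> (complex^'d \<Rightarrow> ('n, 'N) mdata)
    \<Rightarrow> complex^'d \<Rightarrow> complex^'d \<Rightarrow> complex^'d \<Rightarrow> complex" where
  "chart_pullback \<Omega> \<sigma> u a b = \<Omega> (chart_diff \<sigma> u a) (chart_diff \<sigma> u b)"

text \<open>
  The exterior derivative of a 2-form on a vector space, evaluated on constant vector fields.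
\<close>

definition ext_deriv2 :: "('v::real_normed_vector \<Rightarrow> 'v \<Rightarrow> 'v \<Rightarrow> complex)
    \<Rightarrow> 'v \<Rightarrow> 'v \<Rightarrow> 'v \<Rightarrow> 'v \<Rightarrow> complex" where
  "ext_deriv2 \<beta> u a b c =
     differential (\<lambda>x. \<beta> x b c) u a - differential (\<lambda>x. \<beta> x a c) u b
       + differential (\<lambda>x. \<beta> x a b) u c"

text \<open>
  The type argument \<open>'d\<close> is the index type of the chart coordinates. The condition is empty
  unless \<open>CARD('d)\<close> is the dimension of \<open>\<M>\<close>, so it has to be asserted for all \<open>'d\<close>. (If \<open>\<M>\<close> is
  zero-dimensional, there are no charts of this kind, and every form is closed.)
\<close>

definition closed_form :: "'d::finite itself \<Rightarrow> ('n::finite, 'N::{finite,linorder}) mform \<Rightarrow> bool"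
  where
  "closed_form _ \<Omega> \<longleftrightarrow>
     (\<forall>(U :: (complex^'d) set) \<sigma>. quotient_chart U \<sigma> \<longrightarrow>
        (\<forall>u\<in>U. (\<forall>a b. (\<lambda>x. chart_pullback \<Omega> \<sigma> x a b) differentiable (at u)) \<and>
               (\<forall>a b c. ext_deriv2 (chart_pullback \<Omega> \<sigma>) u a b c = 0)))"

end

theory Submission
  imports Defs
begin

text \<open>
For one puncture put \<open>A = C\<inverse> dC\<close>, \<open>D = \<Lambda>\<inverse> d\<Lambda>\<close>, let \<open>K\<close> be the product of the monodromies before it, \<open>N = K M\<close>
the product including it, and \<open>\<gamma> = G\<inverse> dG\<close> for the moving frame \<open>G = K C\<close>. Since \<open>K = G C\<inverse>\<close> and
\<open>N = G \<Lambda> C\<inverse>\<close>, everything in the contribution of the puncture to \<open>4\<pi>i \<omega>\<close> is expressed by \<open>A\<close>, \<open>D\<close> and \<open>\<gamma>\<close>,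
and the second sum of \<open>\<omega>\<^sub>1\<close> cancels the only term quadratic in \<open>A\<close>. Two consequences carry the proof.

Closedness. With the Polyakov-Wiegmann cocycle \<open>c(f, g) = tr (f\<inverse> df \<and> dg g\<inverse>)\<close> the contribution is
\<open>c(G, C\<inverse>) - c(G \<Lambda>, C\<inverse>) - c(G, \<Lambda>)\<close> (\<open>factor_form_eq_cocycles\<close>). The cocycle satisfies
\<open>dc(f, g) = \<chi>(f) + \<chi>(g) - \<chi>(f g)\<close>, where \<open>\<chi>(f)\<close> is the pullback of the Cartan 3-form
\<open>tr (f\<inverse> df [f\<inverse> df, f\<inverse> df])\<close> (\<open>cocycle_ext_deriv\<close>); as \<open>\<chi>(\<Lambda>) = 0\<close> for diagonal \<open>\<Lambda>\<close>, the contribution has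
exterior derivative \<open>\<chi>(N) - \<chi>(K)\<close>. The sum over the punctures telescopes to \<open>\<chi>\<close> of the full product, which is
constant on \<open>\<M>\<close>.

Descent and non-degeneracy. Up to the telescoping difference of \<open>tr (dN N\<inverse> \<cdot> dN N\<inverse>)\<close> and \<open>tr (dK K\<inverse> \<cdot> dK K\<inverse>)\<close>
the contribution, evaluated at \<open>(v, w)\<close>, depends on \<open>w\<close> only through \<open>A(w)\<close> and \<open>D(w)\<close> at the same puncture
(\<open>factor_form_half\<close>, \<open>omega_local\<close>):
\<open>2 tr ((\<Lambda>\<inverse> \<gamma>(v) \<Lambda> - \<gamma>(v) + D(v)) A(w)) - tr ((D(v) + 2 \<gamma>(v)) D(w))\<close>.
For \<open>v = X p\<close> the sum over the punctures telescopes to \<open>-2 tr (X dP P\<inverse>)(w)\<close> for the full product \<open>P\<close>, which is zero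
on tangent vectors \<open>w\<close>; so the gauge directions lie in the radical and \<open>\<omega>\<close> descends. Conversely let \<open>v\<close> be in the
radical. Subtracting a gauge direction makes \<open>\<gamma>(v)\<close> vanish at one chosen puncture. A diagonal variation of \<open>C\<close> there,
which moves no monodromy, then shows \<open>D(v) = 0\<close> at this puncture, so it contributes nothing any more. The constraint
on \<open>w\<close> can be met by adjusting \<open>w\<close> at this puncture alone, because the eigenvalues of \<open>\<Lambda>\<close> are distinct; so \<open>A(w)\<close> and
\<open>D(w)\<close> are free, up to trace zero, at the others.
Hence \<open>\<Lambda>\<inverse> \<gamma> \<Lambda> - \<gamma> + D = 0\<close> and the diagonal of \<open>D + 2 \<gamma>\<close> vanishes, which gives \<open>D = 0\<close> and \<open>\<gamma> = 0\<close> by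
non-resonance. Then all frames \<open>G\<close> and exponents are stationary, and so are all \<open>K\<close> and all \<open>C\<close>: the corrected \<open>v\<close>
is zero.
\<close>

section \<open>Matrix calculus\<close>

lemma matrix_inv_invertible:
  fixes A :: "'a::semiring_1^'n^'m"
  assumes "invertible A"
  shows "A ** matrix_inv A = mat 1" "matrix_inv A ** A = mat 1"
  using someI_ex[OF assms[unfolded invertible_def]] by (simp_all add: matrix_inv_def)

lemma matrix_inv_eqI:
  fixes A B :: "complex^'n^'n"
  assumes "A ** B = mat 1"
  shows "matrix_inv A = B"
proof -
  have "invertible A"
    using assms invertible_def matrix_left_right_inverse by blast
  then have "matrix_inv A ** (A ** B) = B"
    by (simp add: matrix_mul_assoc matrix_inv_invertible)
  then show ?thesis by (simp add: assms)
qed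

lemma invertible_matrix_inv:
  fixes A :: "complex^'n^'n"
  assumes "invertible A"
  shows "invertible (matrix_inv A)" "matrix_inv (matrix_inv A) = A"
  using matrix_inv_invertible[OF assms] matrix_inv_eqI invertible_def by blast+

lemma matrix_inv_mult:
  fixes A B :: "complex^'n^'n"
  assumes "invertible A" "invertible B"
  shows "matrix_inv (A ** B) = matrix_inv B ** matrix_inv A"
proof (rule matrix_inv_eqI)
  have "A ** B ** (matrix_inv B ** matrix_inv A) = A ** (B ** matrix_inv B) ** matrix_inv A"
    by (simp only: matrix_mul_assoc)
  then show "A ** B ** (matrix_inv B ** matrix_inv A) = mat 1"
    using assms by (simp add: matrix_inv_invertible)
qed

lemma matrix_inv_mat_1 [simp]: "matrix_inv (mat 1 :: complex^'n^'n) = mat 1"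
  by (rule matrix_inv_eqI) simp

lemma invertible_mat_1 [simp]: "invertible (mat 1 :: complex^'n^'n)"
  using invertible_def by (metis matrix_mul_lid)

lemma bounded_bilinear_matrix_mult:
  "bounded_bilinear ((**) :: complex^'n^'n \<Rightarrow> complex^'n^'n \<Rightarrow> complex^'n^'n)"
proof -
  have rd: "(A + B) ** C = A ** C + B ** C" for A B C :: "complex^'n^'n"
    by (simp add: matrix_matrix_mult_def vec_eq_iff sum.distrib ring_distribs)
  have ls: "(r *\<^sub>R A) ** B = r *\<^sub>R (A ** B)" for A B :: "complex^'n^'n" and r
    by (simp add: matrix_matrix_mult_def vec_eq_iff scaleR_right.sum)
  have rs: "A ** (r *\<^sub>R B) = r *\<^sub>R (A ** B)" for A B :: "complex^'n^'n" and r
    by (simp add: matrix_matrix_mult_def vec_eq_iff scaleR_right.sum)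
  have "bilinear ((**) :: complex^'n^'n \<Rightarrow> complex^'n^'n \<Rightarrow> complex^'n^'n)"
    unfolding bilinear_def by (intro conjI allI linearI rd ls rs matrix_add_ldistrib)
  then show ?thesis by (simp add: bilinear_conv_bounded_bilinear)
qed

interpretation matrix_mult: bounded_bilinear "(**) :: complex^'n^'n \<Rightarrow> complex^'n^'n \<Rightarrow> complex^'n^'n"
  by (rule bounded_bilinear_matrix_mult)

lemma trace_minus: "trace (- A :: complex^'n^'n) = - trace A"
  by (simp add: trace_def sum_negf)

lemma trace_zero: "trace (0 :: complex^'n^'n) = 0"
  by (simp add: trace_def)

lemma bounded_linear_trace: "bounded_linear (trace :: complex^'n^'n \<Rightarrow> complex)"
  by (auto intro!: linearI simp: linear_conv_bounded_linear[symmetric] trace_add)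
    (simp add: trace_def scaleR_right.sum)

lemma has_derivative_vec_lambda:
  fixes f :: "'n::finite \<Rightarrow> 'a::real_normed_vector \<Rightarrow> 'b::euclidean_space"
  assumes "\<And>i. (f i has_derivative f' i) F"
  shows "((\<lambda>x. \<chi> i. f i x) has_derivative (\<lambda>h. \<chi> i. f' i h)) F"
proof -
  have "bounded_linear (axis i :: 'b \<Rightarrow> 'b^'n)" for i
    by (auto intro!: linearI simp: linear_conv_bounded_linear[symmetric] vec_eq_iff axis_def)
  then have "((\<lambda>x. \<Sum>i\<in>UNIV. axis i (f i x)) has_derivative (\<lambda>h. \<Sum>i\<in>UNIV. axis i (f' i h) :: 'b^'n)) F"
    by (intro has_derivative_sum) (rule bounded_linear.has_derivative[OF _ assms])
  moreover have "(\<Sum>i\<in>UNIV. axis i (g i)) = (\<chi> i. g i)" for g :: "'n \<Rightarrow> 'b"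
    by (simp add: vec_eq_iff axis_def)
  ultimately show ?thesis by simp
qed

lemma differentiable_vec:
  fixes f :: "'a::real_normed_vector \<Rightarrow> 'b::euclidean_space^'n"
  assumes "\<And>i. (\<lambda>x. f x $ i) differentiable F"
  shows "f differentiable F"
proof -
  obtain D where "\<And>i. ((\<lambda>x. f x $ i) has_derivative D i) F"
    using assms unfolding differentiable_def by metis
  from has_derivative_vec_lambda[of "\<lambda>i x. f x $ i", OF this] show ?thesis
    by (auto simp: differentiable_def)
qed

text \<open>
Through Cramer's rule, differentiability of the determinant makes matrix inversion differentiable.
\<close>

lemma differentiable_det:
  fixes f :: "'a::real_normed_vector \<Rightarrow> complex^'n^'n"
  assumes "\<And>i j. (\<lambda>x. f x $ i $ j) differentiable (at u)"
  shows "(\<lambda>x. det (f x)) differentiable (at u)"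
proof -
  have "(\<lambda>x. \<Prod>i\<in>I. f x $ i $ q i) differentiable (at u)" if "finite I" for I and q :: "'n \<Rightarrow> 'n"
    using that by (induction I) (auto intro!: differentiable_mult assms)
  then show ?thesis
    unfolding det_def by (intro differentiable_sum differentiable_mult differentiable_const) auto
qed

lemma differentiable_det_ident: "(det :: complex^'n^'n \<Rightarrow> complex) differentiable (at A)"
proof (rule differentiable_det)
  show "(\<lambda>X :: complex^'n^'n. X $ i $ j) differentiable (at A)" for i j
    by (rule bounded_linear_imp_differentiable,
        rule bounded_linear_compose[OF bounded_linear_vec_nth bounded_linear_vec_nth])
qed

lemma eventually_invertible:
  fixes A :: "complex^'n^'n"
  assumes "invertible A"
  shows "\<forall>\<^sub>F X in at A. invertible X"
proof -
  have "(det \<longlongrightarrow> det A) (at A)"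
    using differentiable_imp_continuous_within[OF differentiable_det_ident, of A]
    by (simp add: continuous_within)
  then have "\<forall>\<^sub>F X in at A. det X \<noteq> 0"
    by (rule tendsto_imp_eventually_ne) (use assms in \<open>simp add: invertible_det_nz\<close>)
  then show ?thesis by (simp add: invertible_det_nz)
qed

lemma differentiable_matrix_inv:
  fixes A :: "complex^'n^'n"
  assumes "invertible A"
  shows "matrix_inv differentiable (at A)"
proof -
  let ?c = "\<lambda>X k j. det (\<chi> i l. if l = j then axis k 1 $ i else X $ i $ l) / det X"
  have comp: "(\<lambda>X :: complex^'n^'n. X $ i $ l) differentiable (at A)" for i l
    by (rule bounded_linear_imp_differentiable,
        rule bounded_linear_compose[OF bounded_linear_vec_nth bounded_linear_vec_nth])
  have det0: "det A \<noteq> 0" using assms by (simp add: invertible_det_nz)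
  have ev: "\<forall>\<^sub>F X in at A. det X \<noteq> 0"
    using eventually_invertible[OF assms] by (simp add: invertible_det_nz)
  have eq: "matrix_inv X $ j $ k = ?c X k j" if "det X \<noteq> 0" for X :: "complex^'n^'n" and j k
  proof -
    have "X ** matrix_inv X = mat 1" using that by (simp add: invertible_det_nz matrix_inv_invertible)
    then have "X *v column k (matrix_inv X) = axis k 1"
      by (auto simp: vec_eq_iff matrix_matrix_mult_def matrix_vector_mult_def column_def mat_def axis_def)
    then have "column k (matrix_inv X) = (\<chi> j. ?c X k j)"
      by (simp add: cramer[OF that])
    then show ?thesis by (simp add: vec_eq_iff column_def)
  qed
  have "(\<lambda>X. matrix_inv X $ j $ k) differentiable (at A)" for j k
  proof -
    have "(\<lambda>X. ?c X k j) differentiable (at A)"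
    proof (rule differentiable_divide[OF differentiable_det differentiable_det_ident det0])
      show "(\<lambda>X. (\<chi> i l. if l = j then axis k 1 $ i else X $ i $ l) $ i' $ l') differentiable (at A)"
        for i' l'
        by (cases "l' = j") (simp_all add: comp)
    qed
    then obtain D where D: "((\<lambda>X. ?c X k j) has_derivative D) (at A)"
      by (auto simp: differentiable_def)
    have "((\<lambda>X. matrix_inv X $ j $ k) has_derivative D) (at A)"
      by (rule has_derivative_transform_eventually[OF D])
        (use ev det0 in \<open>auto elim!: eventually_mono simp: eq\<close>)
    then show ?thesis by (auto simp: differentiable_def)
  qed
  then show ?thesis by (intro differentiable_vec)
qed

text \<open>
Once the inverse is known to be differentiable, its derivative is forced by differentiating \<open>X X\<inverse> = 1\<close>.
\<close>

lemma has_derivative_matrix_inv: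
  fixes f :: "'a::real_normed_vector \<Rightarrow> complex^'n^'n"
  assumes f: "(f has_derivative f') (at x)" and inv: "invertible (f x)"
  shows "((\<lambda>x. matrix_inv (f x)) has_derivative
    (\<lambda>h. - (matrix_inv (f x) ** f' h ** matrix_inv (f x)))) (at x)"
proof -
  obtain D where D: "(matrix_inv has_derivative D) (at (f x))"
    using differentiable_matrix_inv[OF inv] by (auto simp: differentiable_def)
  have 1: "((\<lambda>X. X ** matrix_inv X) has_derivative (\<lambda>H. f x ** D H + H ** matrix_inv (f x))) (at (f x))"
    by (rule matrix_mult.FDERIV[OF has_derivative_ident D])
  have "((\<lambda>X. mat 1 :: complex^'n^'n) has_derivative (\<lambda>H. f x ** D H + H ** matrix_inv (f x))) (at (f x))"
    by (rule has_derivative_transform_eventually[OF 1])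
      (use eventually_invertible[OF inv] inv in \<open>auto simp: matrix_inv_invertible elim!: eventually_mono\<close>)
  from fun_cong[OF has_derivative_unique[OF this has_derivative_const]]
  have eq: "f x ** D H + H ** matrix_inv (f x) = 0" for H .
  have "D H = - (matrix_inv (f x) ** H ** matrix_inv (f x))" for H
  proof -
    have "matrix_inv (f x) ** (f x ** D H + H ** matrix_inv (f x)) = 0" by (simp add: eq)
    then have "D H + matrix_inv (f x) ** H ** matrix_inv (f x) = 0"
      by (simp add: matrix_add_ldistrib matrix_mul_assoc matrix_inv_invertible[OF inv])
    then show ?thesis by (simp add: eq_neg_iff_add_eq_0)
  qed
  with has_derivative_compose[OF f D] show ?thesis by simp
qed

section \<open>Logarithmic derivatives and the contribution of one puncture\<close>

text \<open>
The right logarithmic derivative, which is invariant under right multiplication by constants as \<open>F\<inverse> dF\<close> is under left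
multiplication. The product rule for \<open>f g\<close> combines \<open>f\<inverse> df\<close> with \<open>dg g\<inverse>\<close>.
\<close>

definition rlog_diff ::
    "('a::real_normed_vector \<Rightarrow> complex^'n^'n) \<Rightarrow> 'a \<Rightarrow> 'a \<Rightarrow> complex^'n^'n" where
  "rlog_diff F p v = differential F p v ** matrix_inv (F p)"

lemmas matrix_ring_simps = matrix_add_ldistrib matrix_mult.add_left matrix_mult.diff_left matrix_mult.diff_right
  matrix_mult.minus_left matrix_mult.minus_right matrix_mul_assoc[symmetric]

lemmas trace_expand = matrix_add_ldistrib matrix_mult.add_left matrix_mult.diff_left matrix_mult.diff_right matrix_mult.minus_left
  matrix_mult.minus_right trace_add trace_sub trace_minus

lemma matrix_inv_cancel:
  fixes A B :: "complex^'n^'n"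
  assumes "invertible A"
  shows "A ** matrix_inv A = mat 1" "matrix_inv A ** A = mat 1"
    "A ** (matrix_inv A ** B) = B" "matrix_inv A ** (A ** B) = B"
  using matrix_inv_invertible[OF assms] by (simp_all add: matrix_mul_assoc)

lemma trace_conj:
  fixes A B :: "complex^'n^'n"
  assumes "invertible A"
  shows "trace (A ** (B ** matrix_inv A)) = trace B" "trace (matrix_inv A ** (B ** A)) = trace B"
  using assms trace_mul_sym[of A "B ** matrix_inv A"] trace_mul_sym[of "matrix_inv A" "B ** A"]
  by (simp_all add: matrix_mul_assoc[symmetric] matrix_inv_cancel)

text \<open>
All logarithmic derivatives of one puncture are conjugates by \<open>C\<close> or by \<open>K C\<close>; this strips the common frame from
their pairings.
\<close>

lemma trace_conj_mult:
  fixes P :: "complex^'n^'n"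
  assumes "invertible P"
  shows "trace (P ** X ** matrix_inv P ** (P ** Y ** matrix_inv P)) = trace (X ** Y)"
  using trace_conj(1)[OF assms, of "X ** Y"]
  by (simp add: matrix_mul_assoc[symmetric] matrix_inv_cancel assms)

lemma differential_matrix_mult:
  fixes f g :: "'a::real_normed_vector \<Rightarrow> complex^'n^'n"
  assumes "f differentiable (at p)" "g differentiable (at p)"
  shows "differential (\<lambda>x. f x ** g x) p v
    = f p ** differential g p v + differential f p v ** g p"
  by (rule fun_cong[OF frechet_derivative_at[OF matrix_mult.FDERIV[OF assms[unfolded frechet_derivative_works]]], symmetric])

lemma differentiable_matrix_mult:
  fixes f g :: "'a::real_normed_vector \<Rightarrow> complex^'n^'n"
  assumes "f differentiable (at p)" "g differentiable (at p)"
  shows "(\<lambda>x. f x ** g x) differentiable (at p)"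
  using matrix_mult.FDERIV[OF assms[unfolded frechet_derivative_works]] by (auto simp: differentiable_def)

context
  fixes f :: "'a::real_normed_vector \<Rightarrow> complex^'n^'n" and p :: 'a
  assumes f: "f differentiable (at p)" and fi: "invertible (f p)"
begin

lemma differential_matrix_inv:
  "differential (\<lambda>x. matrix_inv (f x)) p v = - (matrix_inv (f p) ** differential f p v ** matrix_inv (f p))"
  by (rule fun_cong[OF frechet_derivative_at[OF
        has_derivative_matrix_inv[OF f[unfolded frechet_derivative_works] fi]], symmetric])

lemma differentiable_matrix_inv_comp: "(\<lambda>x. matrix_inv (f x)) differentiable (at p)"
  using has_derivative_matrix_inv[OF f[unfolded frechet_derivative_works] fi]
  by (auto simp: differentiable_def)

lemma rlog_diff_eq_conj: "rlog_diff f p v = f p ** log_diff f p v ** matrix_inv (f p)"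
  using fi by (simp add: rlog_diff_def log_diff_def matrix_mul_assoc matrix_inv_cancel)

lemma rlog_diff_inv: "rlog_diff (\<lambda>x. matrix_inv (f x)) p v = - log_diff f p v"
  using fi by (simp add: rlog_diff_def log_diff_def differential_matrix_inv invertible_matrix_inv
      matrix_ring_simps matrix_inv_cancel)

context
  fixes g :: "'a \<Rightarrow> complex^'n^'n"
  assumes g: "g differentiable (at p)" and gi: "invertible (g p)"
begin

lemma log_diff_mult:
  "log_diff (\<lambda>x. f x ** g x) p v = matrix_inv (g p) ** (log_diff f p v + rlog_diff g p v) ** g p"
  using fi gi f g by (simp add: rlog_diff_def log_diff_def differential_matrix_mult matrix_inv_mult
      matrix_ring_simps matrix_inv_cancel add.commute)

end
end

text \<open>
The Polyakov-Wiegmann 2-cocycle of the group of invertible matrices, pulled back along the pair \<open>(f, g)\<close>.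
\<close>

definition cocycle ::
  "('a::real_normed_vector \<Rightarrow> complex^'n^'n) \<Rightarrow> ('a \<Rightarrow> complex^'n^'n) \<Rightarrow> 'a \<Rightarrow> 'a \<Rightarrow> 'a \<Rightarrow> complex" where
  "cocycle f g p = tr_wedge (log_diff f p) (rlog_diff g p)"

text \<open>
One puncture: \<open>C\<close> diagonalizes the monodromy, \<open>L\<close> stands for \<open>\<Lambda>\<close>, and \<open>K\<close> is the product of the preceding
monodromies. Diagonality of \<open>\<Lambda>\<close> is expressed by the commutation of \<open>L\<close> with its own derivative.
The functions live on an arbitrary normed space, so that the same computation serves on the space of monodromy
data and in a chart.
\<close>

locale monodromy_factor =
  fixes C L K :: "'a::real_normed_vector \<Rightarrow> complex^'n^'n" and p :: 'a
  assumes diff: "C differentiable (at p)" "L differentiable (at p)" "K differentiable (at p)"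
    and inv: "invertible (C p)" "invertible (L p)" "invertible (K p)"
    and comm: "\<And>v. L p ** log_diff L p v = log_diff L p v ** L p"
begin

abbreviation "Ci x \<equiv> matrix_inv (C x)"
abbreviation "M x \<equiv> C x ** L x ** matrix_inv (C x)"
abbreviation "G x \<equiv> K x ** C x"
abbreviation "GL x \<equiv> K x ** C x ** L x"
abbreviation "N x \<equiv> K x ** (C x ** L x ** matrix_inv (C x))"
abbreviation "conjL X \<equiv> matrix_inv (L p) ** X ** L p"
abbreviation "conjL' X \<equiv> L p ** X ** matrix_inv (L p)"
abbreviation "A v \<equiv> log_diff C p v"
abbreviation "D v \<equiv> log_diff L p v"
abbreviation "\<gamma> v \<equiv> log_diff G p v"

lemma factor_diff: "G differentiable (at p)" "GL differentiable (at p)" "M differentiable (at p)"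
    "N differentiable (at p)" "Ci differentiable (at p)" "(\<lambda>x. C x ** L x) differentiable (at p)"
  by (intro differentiable_matrix_mult differentiable_matrix_inv_comp diff inv)+

lemma factor_inv: "invertible (G p)" "invertible (GL p)" "invertible (M p)" "invertible (N p)"
    "invertible (Ci p)" "invertible (C p ** L p)"
  by (intro invertible_mult invertible_matrix_inv inv)+

lemma L_conj:
  "L p ** (D v ** X) = D v ** (L p ** (X :: complex^'n^'n))"
  "D v ** matrix_inv (L p) = matrix_inv (L p) ** D v"
proof -
  show "L p ** (D v ** X) = D v ** (L p ** X)"
    by (simp add: matrix_mul_assoc comm)
  have "D v = matrix_inv (L p) ** (D v ** L p)"
    using inv by (simp add: comm[symmetric] matrix_inv_cancel)
  then have "D v ** matrix_inv (L p) = matrix_inv (L p) ** D v ** (L p ** matrix_inv (L p))"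
    by (metis matrix_mul_assoc)
  then show "D v ** matrix_inv (L p) = matrix_inv (L p) ** D v"
    using inv by (simp add: matrix_inv_cancel)
qed

lemma L_conj_D: "L p ** (D v ** matrix_inv (L p)) = D v" "matrix_inv (L p) ** (D v ** L p) = D v"
   "matrix_inv (L p) ** (D v ** (L p ** X)) = D v ** (X :: complex^'n^'n)"
   "L p ** (D v ** (matrix_inv (L p) ** X)) = D v ** (X :: complex^'n^'n)"
proof -
  show "L p ** (D v ** matrix_inv (L p)) = D v"
    using inv by (simp add: L_conj(1) matrix_inv_cancel)
  show "matrix_inv (L p) ** (D v ** L p) = D v"
    using inv by (simp add: comm[symmetric] matrix_inv_cancel)
  show "matrix_inv (L p) ** (D v ** (L p ** X)) = D v ** X"
    by (simp only: L_conj(1)[symmetric] matrix_inv_cancel(4)[OF inv(2)])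
  show "L p ** (D v ** (matrix_inv (L p) ** X)) = D v ** X"
    by (simp only: L_conj(1) matrix_inv_cancel(3)[OF inv(2)])
qed

lemma rlog_diff_L: "rlog_diff L p v = D v"
  using rlog_diff_eq_conj[OF diff(2) inv(2)] by (simp add: matrix_mul_assoc[symmetric] L_conj_D)

lemma log_diff_GL: "log_diff GL p v = conjL (\<gamma> v) + D v"
  unfolding log_diff_mult[OF factor_diff(1) factor_inv(1) diff(2) inv(2)]
  by (simp add: rlog_diff_L matrix_ring_simps L_conj_D)

lemma log_diff_M: "log_diff M p v = C p ** (conjL (A v) + D v - A v) ** matrix_inv (C p)"
  unfolding log_diff_mult[OF factor_diff(6) factor_inv(6) factor_diff(5) factor_inv(5)]
      log_diff_mult[OF diff(1) inv(1) diff(2) inv(2)] rlog_diff_inv[OF diff(1) inv(1)]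
  by (simp add: invertible_matrix_inv inv rlog_diff_L matrix_ring_simps L_conj_D)

text \<open>
The product including the puncture is \<open>N = (G L) C\<inverse>\<close>, so it has the same shape as \<open>K = G C\<inverse>\<close>, with \<open>\<gamma>\<close> replaced by
the logarithmic derivative of \<open>G L\<close>.
\<close>

lemma log_diff_N: "log_diff N p v = C p ** (conjL (\<gamma> v) + D v - A v) ** matrix_inv (C p)"
proof -
  have N: "N = (\<lambda>x. GL x ** matrix_inv (C x))" by (simp add: matrix_mul_assoc)
  show ?thesis
    unfolding N log_diff_mult[OF factor_diff(2) factor_inv(2) factor_diff(5) factor_inv(5)]
      log_diff_GL rlog_diff_inv[OF diff(1) inv(1)]
    by (simp add: invertible_matrix_inv inv matrix_ring_simps)
qed

lemma log_diff_K: "log_diff K p v = C p ** (\<gamma> v - A v) ** matrix_inv (C p)"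
  using inv by (simp add: log_diff_mult[OF diff(3) inv(3) diff(1) inv(1)]
      rlog_diff_eq_conj[OF diff(1) inv(1)] matrix_ring_simps matrix_inv_cancel)

lemma rlog_diff_K: "rlog_diff K p v = G p ** (\<gamma> v - A v) ** matrix_inv (G p)"
  unfolding rlog_diff_eq_conj[OF diff(3) inv(3)] log_diff_K
  using inv by (simp add: matrix_ring_simps matrix_inv_mult)

lemma rlog_diff_N: "rlog_diff N p v = G p ** (\<gamma> v + D v - conjL' (A v)) ** matrix_inv (G p)"
  unfolding rlog_diff_eq_conj[OF factor_diff(4) factor_inv(4)] log_diff_N
  using inv by (simp add: matrix_ring_simps matrix_inv_mult invertible_mult invertible_matrix_inv
      matrix_inv_cancel L_conj_D)

text \<open>
The moving frame derivative \<open>\<gamma>\<close> drops out of the increment of \<open>dK K\<inverse>\<close>, which therefore depends only on the data at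
the puncture itself. This is what makes the constraint solvable by varying one puncture.
\<close>

lemma rlog_diff_step:
  "rlog_diff N p v - rlog_diff K p v = G p ** (D v - conjL' (A v) + A v) ** matrix_inv (G p)"
  unfolding rlog_diff_N rlog_diff_K by (simp add: matrix_ring_simps)

lemma trace_conjL:
  "trace (conjL X ** conjL Y) = trace (X ** Y)"
  "trace (conjL X ** D v) = trace (X ** D v)" "trace (D v ** conjL X) = trace (D v ** X)"
proof -
  show 1: "trace (conjL X ** conjL Y) = trace (X ** Y)" for X Y
    using trace_conj(2)[OF inv(2), of "X ** Y"] inv
    by (simp add: matrix_mul_assoc[symmetric] matrix_inv_cancel)
  have "conjL (D v) = D v"
    by (simp add: matrix_mul_assoc[symmetric] L_conj_D)
  with 1[of X "D v"] 1[of "D v" X]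
  show "trace (conjL X ** D v) = trace (X ** D v)" "trace (D v ** conjL X) = trace (D v ** X)"
    by simp_all
qed

lemma trace_conjL':
  "trace (conjL' X ** conjL' Y) = trace (X ** Y)"
  "trace (conjL' X ** D v) = trace (X ** D v)" "trace (D v ** conjL' X) = trace (D v ** X)"
  "trace (X ** conjL' Y) = trace (conjL X ** Y)" "trace (conjL' Y ** X) = trace (Y ** conjL X)"
proof -
  have LL: "conjL (conjL' X) = X" for X
    using inv by (simp add: matrix_mul_assoc[symmetric] matrix_inv_cancel)
  show "trace (conjL' X ** conjL' Y) = trace (X ** Y)"
    "trace (conjL' X ** D v) = trace (X ** D v)" "trace (D v ** conjL' X) = trace (D v ** X)"
    "trace (X ** conjL' Y) = trace (conjL X ** Y)" "trace (conjL' Y ** X) = trace (Y ** conjL X)"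
    using trace_conjL(1)[of "conjL' X" "conjL' Y"] trace_conjL(2)[of "conjL' X"] trace_conjL(3)[of _ "conjL' X"]
     trace_conjL(1)[of X "conjL' Y"] trace_conjL(1)[of "conjL' Y" X]
    by (simp_all only: LL)
qed

text \<open>
The summand of \<open>\<omega>\<^sub>1 + \<omega>\<^sub>2\<close> that belongs to one puncture.
\<close>

definition factor_form :: "'a \<Rightarrow> 'a \<Rightarrow> complex" where
  "factor_form v w = tr_wedge (log_diff M p) (log_diff N p) v w
    + tr_wedge (\<lambda>v. matrix_inv (L p) ** A v) (\<lambda>v. L p ** A v) v w
    + 2 * tr_wedge D A v w"

text \<open>
The term \<open>tr (A \<and> L\<inverse> A L)\<close> from the product of \<open>M\<inverse> dM\<close> and \<open>N\<inverse> dN\<close> is cancelled by the second sum of \<open>\<omega>\<^sub>1\<close>,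
and \<open>\<omega>\<^sub>2\<close> corrects the coefficient of \<open>tr (D \<and> A)\<close>.
\<close>

lemma factor_form_eq:
  "factor_form v w = tr_wedge (\<lambda>v. conjL (\<gamma> v) - \<gamma> v + D v) A v w - tr_wedge \<gamma> D v w"
proof -
  define s where "s X = conjL X" for X
  have LL: "trace (matrix_inv (L p) ** X ** (L p ** Y)) = trace (s X ** Y)" for X Y
    by (simp add: matrix_mul_assoc s_def)
  note sym = trace_mul_sym[of "D w" "D v"] trace_mul_sym[of "D w" "A v"] trace_mul_sym[of "D v" "A w"]
    trace_mul_sym[of "A w" "A v"] trace_mul_sym[of "s (A w)" "A v"] trace_mul_sym[of "s (A v)" "A w"]
    trace_mul_sym[of "\<gamma> w" "A v"] trace_mul_sym[of "\<gamma> v" "A w"]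
    trace_mul_sym[of "\<gamma> w" "D v"] trace_mul_sym[of "\<gamma> v" "D w"]
    trace_mul_sym[of "s (\<gamma> w)" "A v"] trace_mul_sym[of "s (\<gamma> v)" "A w"]
  show ?thesis
    unfolding factor_form_def tr_wedge_def log_diff_M log_diff_N trace_conj_mult[OF inv(1)] s_def[symmetric] LL
    by (simp only: trace_expand trace_conjL[folded s_def] sym) (simp add: algebra_simps)
qed

lemma factor_form_eq_cocycles:
  "factor_form v w = cocycle G Ci p v w - cocycle GL Ci p v w - cocycle G L p v w"
proof -
  define s where "s X = conjL X" for X
  note sym = trace_mul_sym[of "D w" "A v"] trace_mul_sym[of "D v" "A w"]
  show ?thesis
    unfolding factor_form_eq cocycle_def tr_wedge_def log_diff_GL rlog_diff_inv[OF diff(1) inv(1)]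
      rlog_diff_L s_def[symmetric]
    by (simp only: trace_expand trace_conjL[folded s_def] sym) (simp add: algebra_simps)
qed

text \<open>
The form antisymmetrizes an expression in which \<open>w\<close> enters only through the local \<open>A(w)\<close> and \<open>D(w)\<close>. Exchanging
\<open>v\<close> and \<open>w\<close> changes the sign of that expression up to \<open>tr (D(v) D(w))\<close> and a difference that telescopes over the
punctures. Hence the expression counts twice, and the nonlocal \<open>\<gamma>(w)\<close> disappears.
\<close>

lemma factor_form_half:
  "factor_form v w
   = 2 * trace ((conjL (\<gamma> v) - \<gamma> v + D v) ** A w) - trace ((D v + \<gamma> v + \<gamma> v) ** D w)
     + trace (rlog_diff N p v ** rlog_diff N p w) - trace (rlog_diff K p v ** rlog_diff K p w)"
proof -
  define s where "s X = conjL X" for X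
  define t where "t X = conjL' X" for X
  have st: "s (t X) = X" for X
    using inv by (simp add: s_def t_def matrix_mul_assoc[symmetric] matrix_inv_cancel)
  have sD: "s (D v) = D v" for v
    by (simp add: s_def matrix_mul_assoc[symmetric] L_conj_D)
  note sym = trace_mul_sym[of "D w" "D v"] trace_mul_sym[of "D w" "A v"] trace_mul_sym[of "D v" "A w"]
    trace_mul_sym[of "A w" "A v"]
    trace_mul_sym[of "\<gamma> w" "A v"] trace_mul_sym[of "\<gamma> v" "A w"]
    trace_mul_sym[of "\<gamma> w" "D v"] trace_mul_sym[of "\<gamma> v" "D w"] trace_mul_sym[of "\<gamma> v" "\<gamma> w"]
    trace_mul_sym[of "s (\<gamma> w)" "A v"] trace_mul_sym[of "s (\<gamma> v)" "A w"]
  show ?thesis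
    unfolding factor_form_eq tr_wedge_def rlog_diff_N rlog_diff_K trace_conj_mult[OF factor_inv(1)] s_def[symmetric] t_def[symmetric]
    by (simp only: trace_expand trace_conjL'[folded s_def t_def] trace_conjL[folded s_def] st sD sym) (simp add: algebra_simps)
qed

text \<open>
Here \<open>Y\<close> is the moving frame derivative of the infinitesimal action of \<open>X\<close>. The right-hand side is, up to
the factor \<open>-2\<close>, what the local formula gives for that direction, and the left-hand side telescopes.
\<close>

lemma trace_rlog_diff_step:
  assumes "Y = matrix_inv (G p) ** X ** G p"
  shows "trace (X ** (rlog_diff N p w - rlog_diff K p w))
    = trace (Y ** D w) - trace ((conjL Y - Y) ** A w)"
proof -
  have "trace (X ** (rlog_diff N p w - rlog_diff K p w))
      = trace (X ** G p ** (D w - conjL' (A w) + A w) ** matrix_inv (G p))"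
    unfolding rlog_diff_step by (simp only: matrix_mul_assoc)
  also have "\<dots> = trace (Y ** (D w - conjL' (A w) + A w))"
    unfolding assms by (subst trace_mul_sym) (simp only: matrix_mul_assoc)
  also have "\<dots> = trace (Y ** D w) - trace ((conjL Y - Y) ** A w)"
    by (simp only: trace_expand trace_conjL') simp
  finally show ?thesis .
qed

end

section \<open>Exponentials of diagonal matrices and partial products\<close>

lemma bounded_linear_diag_mat: "bounded_linear (diag_mat :: complex^'n \<Rightarrow> complex^'n^'n)"
  by (auto intro!: linearI simp: linear_conv_bounded_linear[symmetric] vec_eq_iff diag_mat_def)

lemma scaleR_diag_mat: "r *\<^sub>R diag_mat a = diag_mat (\<chi> i. r *\<^sub>R a $ i)"
  by (simp add: vec_eq_iff diag_mat_def)

lemma diag_mat_mult: "diag_mat a ** diag_mat b = diag_mat (\<chi> i. a $ i * b $ i)"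
proof -
  have "(\<Sum>k\<in>UNIV. diag_mat a $ i $ k * diag_mat b $ k $ j)
    = (\<Sum>k\<in>UNIV. if k = i then a $ i * diag_mat b $ i $ j else 0)" for i j
    by (rule sum.cong) (auto simp: diag_mat_def)
  then show ?thesis
    by (simp add: vec_eq_iff matrix_matrix_mult_def) (simp add: diag_mat_def)
qed

lemma diag_mat_commute: "diag_mat a ** diag_mat b = diag_mat b ** diag_mat a"
  by (simp add: diag_mat_mult mult.commute)

lemma mpow_diag_mat: "mpow (diag_mat a) k = diag_mat (\<chi> i. a $ i ^ k)"
proof (induction k)
  case 0 show ?case by (simp add: mpow_def diag_mat_def mat_def vec_eq_iff)
next
  case (Suc k) then show ?case by (simp add: mpow_def diag_mat_mult)
qed

text \<open>
The defining series converges entry by entry, because the powers of a diagonal matrix are diagonal.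
\<close>

lemma mexp_diag_mat: "mexp (diag_mat a) = diag_mat (\<chi> i. exp (a $ i))"
proof -
  have "(\<lambda>k. \<chi> i. (1 / fact k) *\<^sub>R a $ i ^ k) sums (\<chi> i. exp (a $ i))"
    unfolding sums_def
  proof (rule vec_tendstoI)
    fix i
    have "(\<lambda>k. (1 / fact k) *\<^sub>R a $ i ^ k) sums exp (a $ i)"
      using exp_converges[of "a $ i"] by (simp add: inverse_eq_divide)
    then show "(\<lambda>n. (\<Sum>k<n. \<chi> i. (1 / fact k) *\<^sub>R a $ i ^ k) $ i) \<longlonglongrightarrow> (\<chi> i. exp (a $ i)) $ i"
      by (simp add: sums_def)
  qed
  from bounded_linear.sums[OF bounded_linear_diag_mat this]
  have "(\<lambda>k. (1 / fact k) *\<^sub>R mpow (diag_mat a) k) sums diag_mat (\<chi> i. exp (a $ i))"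
    unfolding mpow_diag_mat by (simp only: scaleR_diag_mat vec_lambda_beta)
  then show ?thesis unfolding mexp_def by (rule sums_unique[symmetric])
qed

lemma msmult_diag_mat: "msmult c (diag_mat l) = diag_mat (\<chi> i. c * l $ i)"
  by (auto simp: vec_eq_iff diag_mat_def msmult_def)

lemma has_derivative_exp_diag:
  fixes l :: "'a::real_normed_vector \<Rightarrow> complex^'n"
  assumes "(l has_derivative l') (at x)"
  shows "((\<lambda>x. diag_mat (\<chi> i. exp (c * l x $ i))) has_derivative
    (\<lambda>h. diag_mat (\<chi> i. exp (c * l x $ i)) ** diag_mat (\<chi> i. c * l' h $ i))) (at x)"
proof -
  have "((\<lambda>x. exp (c * l x $ i)) has_derivative (\<lambda>h. exp (c * l x $ i) * (c * l' h $ i))) (at x)" for i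
  proof -
    have "((\<lambda>x. c * l x $ i) has_derivative (\<lambda>h. c * l' h $ i)) (at x)"
      by (intro has_derivative_mult_right bounded_linear.has_derivative[OF bounded_linear_vec_nth assms])
    from has_derivative_compose[OF this DERIV_exp[unfolded has_field_derivative_def]]
    show ?thesis .
  qed
  from bounded_linear.has_derivative[OF bounded_linear_diag_mat has_derivative_vec_lambda, OF this]
  show ?thesis by (simp add: diag_mat_mult)
qed

text \<open>
Telescoping along a finite linear order without enumerating it: the sets \<open>{..j}\<close> and \<open>{..<j}\<close> take the place of
consecutive indices.
\<close>

lemma sum_telescope_linorder:
  fixes h :: "'N::{finite,linorder} set \<Rightarrow> 'b::ab_group_add"
  assumes down: "\<And>i j. i \<in> A \<Longrightarrow> j \<le> i \<Longrightarrow> j \<in> A"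
  shows "(\<Sum>j\<in>A. h {..j} - h {..<j}) = h A - h {}"
proof -
  have "(\<Sum>j\<in>A. h (A \<inter> {..j}) - h (A \<inter> {..<j})) = h A - h {}" for A :: "'N set"
    using finite[of A]
  proof (induction A rule: finite_linorder_max_induct)
    case (insert b A)
    have "insert b A \<inter> {..j} = A \<inter> {..j}" "insert b A \<inter> {..<j} = A \<inter> {..<j}" if "j \<in> A" for j
      using that insert.hyps(2) by auto
    moreover have "insert b A \<inter> {..b} = insert b A" "insert b A \<inter> {..<b} = A" "b \<notin> A"
      using insert.hyps(2) by (auto intro: less_imp_le)
    ultimately show ?case using insert by simp
  qed simp
  moreover have "A \<inter> {..j} = {..j}" "A \<inter> {..<j} = {..<j}" if "j \<in> A" for j
    using down[OF that] by (auto dest: less_imp_le)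
  ultimately show ?thesis by (metis (no_types, lifting) sum.cong)
qed

text \<open>
The ordered product over an arbitrary set of punctures. It covers \<open>K\<^sub>l\<close>, the product before \<open>K\<^sub>l\<close>, and the full
product at once, and it is the function of sets that is telescoped.
\<close>

definition partial_prod :: "'N set \<Rightarrow> ('n::finite, 'N::{finite,linorder}) mdata \<Rightarrow> complex^'n^'n" where
  "partial_prod S p = mprod (map (\<lambda>j. Mmat j p) (sorted_list_of_set S))"

lemma partial_prod_empty [simp]: "partial_prod {} p = mat 1"
  by (simp add: partial_prod_def mprod_def)

lemma mprod_snoc: "mprod (xs @ [x]) = mprod xs ** x"
  by (induction xs) (simp_all add: mprod_def matrix_mul_assoc)

lemma sorted_list_of_set_insert_max:
  assumes "finite S" "\<And>a. a \<in> S \<Longrightarrow> a < b"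
  shows "sorted_list_of_set (insert b S) = sorted_list_of_set S @ [b]"
proof -
  have "sorted (sorted_list_of_set S @ [b])" "distinct (sorted_list_of_set S @ [b])"
    "set (sorted_list_of_set S @ [b]) = insert b S"
    using assms by (auto simp: sorted_append intro: less_imp_le)
  then show ?thesis
    by (metis sorted_list_of_set.idem_if_sorted_distinct)
qed

lemma partial_prod_insert:
  assumes "\<And>a. a \<in> S \<Longrightarrow> a < b"
  shows "partial_prod (insert b S) p = partial_prod S p ** Mmat b p"
  using sorted_list_of_set_insert_max[OF finite assms]
  by (simp add: partial_prod_def mprod_snoc del: sorted_list_of_set_insert_remove)

lemma partial_prod_atMost: "partial_prod {..j} p = partial_prod {..<j} p ** Mmat j p"
proof -
  have "{..j} = insert j {..<j}" by auto
  then show ?thesis using partial_prod_insert[of "{..<j}" j p] by simp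
qed

lemma Kmat_eq: "Kmat j = partial_prod {..j}"
  by (simp add: fun_eq_iff Kmat_def partial_prod_def)

lemma total_eq: "total_monodromy = partial_prod UNIV"
  by (simp add: fun_eq_iff total_monodromy_def partial_prod_def)

lemma Lam_eq: "Lam j p = diag_mat (\<chi> i. exp (2 * of_real pi * \<i> * snd p $ j $ i))"
  by (simp add: Lam_def Lmat_def msmult_diag_mat mexp_diag_mat)

lemma bounded_linear_Cmat: "bounded_linear (Cmat j)"
  by (auto intro!: linearI simp: linear_conv_bounded_linear[symmetric] Cmat_def)

lemma bounded_linear_exponents: "bounded_linear (\<lambda>p :: ('n::finite, 'N::finite) mdata. snd p $ j)"
  by (auto intro!: linearI simp: linear_conv_bounded_linear[symmetric])

lemma invertible_Lam: "invertible (Lam j p)"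
proof -
  have "Lam j p ** diag_mat (\<chi> i. exp (- (2 * of_real pi * \<i> * snd p $ j $ i))) = mat 1"
    by (simp add: Lam_eq diag_mat_mult mult_exp_exp) (simp add: diag_mat_def mat_def vec_eq_iff)
  then show ?thesis using invertible_def matrix_left_right_inverse by blast
qed

text \<open>
The open set of data that contains the constraint set and on which all logarithmic derivatives make sense.
\<close>

definition frames_invertible :: "('n::finite, 'N::finite) mdata \<Rightarrow> bool" where
  "frames_invertible p \<longleftrightarrow> (\<forall>j. invertible (Cmat j p))"

lemma invertible_Mmat: "frames_invertible p \<Longrightarrow> invertible (Mmat j p)"
  unfolding Mmat_def frames_invertible_def
  by (intro invertible_mult invertible_matrix_inv invertible_Lam) auto

lemma invertible_partial_prod:
  fixes p :: "('n::finite, 'N::{finite,linorder}) mdata"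
  assumes "frames_invertible p"
  shows "invertible (partial_prod S p)"
  using finite[of S]
  by (induction S rule: finite_linorder_max_induct)
    (auto simp: partial_prod_insert intro!: invertible_mult invertible_Mmat assms)

lemma Lam_has_derivative:
  "(Lam j has_derivative (\<lambda>v. Lam j p ** msmult (2 * of_real pi * \<i>) (Lmat j v))) (at p)"
  using has_derivative_exp_diag[OF bounded_linear_imp_has_derivative[OF bounded_linear_exponents],
      of "2 * of_real pi * \<i>" j p]
  by (simp add: Lam_eq[abs_def] Lmat_def msmult_diag_mat)

lemma Cmat_differentiable: "Cmat j differentiable (at p)"
  by (rule bounded_linear_imp_differentiable[OF bounded_linear_Cmat])

lemma Lam_differentiable: "Lam j differentiable (at p)"
  unfolding differentiable_def by (rule exI, rule Lam_has_derivative)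

lemma log_diff_Cmat: "log_diff (Cmat j) p v = matrix_inv (Cmat j p) ** Cmat j v"
  unfolding log_diff_def
    frechet_derivative_at[OF bounded_linear_imp_has_derivative[OF bounded_linear_Cmat], symmetric] ..

lemma log_diff_Lam: "log_diff (Lam j) p v = msmult (2 * of_real pi * \<i>) (Lmat j v)"
  unfolding log_diff_def frechet_derivative_at[OF Lam_has_derivative, symmetric]
  by (simp add: matrix_inv_cancel invertible_Lam)

lemma Mmat_differentiable:
  assumes "frames_invertible p"
  shows "Mmat j differentiable (at p)"
  unfolding Mmat_def[abs_def] using assms
  by (intro differentiable_matrix_mult differentiable_matrix_inv_comp Cmat_differentiable Lam_differentiable)
    (simp add: frames_invertible_def)

lemma partial_prod_differentiable:
  fixes p :: "('n::finite, 'N::{finite,linorder}) mdata"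
  assumes "frames_invertible p"
  shows "partial_prod S differentiable (at p)"
  using finite[of S]
proof (induction S rule: finite_linorder_max_induct)
  case empty
  have "partial_prod {} = (\<lambda>p :: ('n, 'N) mdata. mat 1)" by (simp add: fun_eq_iff)
  then show ?case by simp
next
  case (insert b S)
  have "partial_prod (insert b S) = (\<lambda>p :: ('n, 'N) mdata. partial_prod S p ** Mmat b p)"
    using insert.hyps by (auto simp: fun_eq_iff partial_prod_insert)
  then show ?case
    using insert.IH by (simp add: differentiable_matrix_mult Mmat_differentiable assms)
qed

lemma log_diff_compose:
  assumes "\<sigma> differentiable (at u)" "F differentiable (at (\<sigma> u))"
  shows "log_diff (\<lambda>x. F (\<sigma> x)) u a = log_diff F (\<sigma> u) (differential \<sigma> u a)"
  using frechet_derivative_compose[OF assms] by (simp add: log_diff_def o_def)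

lemma differentiable_compose_at:
  assumes "\<sigma> differentiable (at u)" "F differentiable (at (\<sigma> u))"
  shows "(\<lambda>x. F (\<sigma> x)) differentiable (at u)"
  using differentiable_chain_at[OF assms] by (simp add: o_def)

text \<open>
Along a differentiable family of monodromy data, each puncture is an instance of the locale. The identity family
gives the statements on the space of all data.
\<close>

lemma monodromy_factor_pullback:
  fixes \<sigma> :: "'a::real_normed_vector \<Rightarrow> ('n::finite, 'N::{finite,linorder}) mdata"
  assumes \<sigma>: "\<sigma> differentiable (at u)" and p: "frames_invertible (\<sigma> u)"
  shows "monodromy_factor (\<lambda>u. Cmat j (\<sigma> u)) (\<lambda>u. Lam j (\<sigma> u)) (\<lambda>u. partial_prod {..<j} (\<sigma> u)) u"
proof
  show "(\<lambda>u. Cmat j (\<sigma> u)) differentiable at u" "(\<lambda>u. Lam j (\<sigma> u)) differentiable at u"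
    "(\<lambda>u. partial_prod {..<j} (\<sigma> u)) differentiable at u"
    by (rule differentiable_compose_at[OF \<sigma> Cmat_differentiable]
        differentiable_compose_at[OF \<sigma> Lam_differentiable]
        differentiable_compose_at[OF \<sigma> partial_prod_differentiable[OF p]])+
  show "invertible (Cmat j (\<sigma> u))" "invertible (Lam j (\<sigma> u))" "invertible (partial_prod {..<j} (\<sigma> u))"
    using p by (auto simp: frames_invertible_def invertible_Lam invertible_partial_prod)
  show "Lam j (\<sigma> u) ** log_diff (\<lambda>u. Lam j (\<sigma> u)) u v = log_diff (\<lambda>u. Lam j (\<sigma> u)) u v ** Lam j (\<sigma> u)" for v
    unfolding log_diff_compose[OF \<sigma> Lam_differentiable] log_diff_Lam
    by (simp add: Lam_eq Lmat_def msmult_diag_mat diag_mat_commute)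
qed

lemma monodromy_factor_at:
  fixes p :: "('n::finite, 'N::{finite,linorder}) mdata"
  assumes "frames_invertible p"
  shows "monodromy_factor (Cmat j) (Lam j) (partial_prod {..<j}) p"
  using monodromy_factor_pullback[of "\<lambda>x. x" p j] assms by simp

lemma omega_eq_factor_forms:
  fixes p :: "('n::finite, 'N::{finite,linorder}) mdata"
  assumes "frames_invertible p"
  shows "omega p v w = 1 / (4 * of_real pi * \<i>) *
    (\<Sum>j\<in>UNIV. monodromy_factor.factor_form (Cmat j) (Lam j) (partial_prod {..<j}) p v w)"
proof -
  have "Mmat j = (\<lambda>x :: ('n, 'N) mdata. Cmat j x ** Lam j x ** matrix_inv (Cmat j x))" for j
    by (simp add: fun_eq_iff Mmat_def)
  moreover have "Kmat j = (\<lambda>x :: ('n, 'N) mdata. partial_prod {..<j} x ** (Cmat j x ** Lam j x ** matrix_inv (Cmat j x)))" for j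
    by (simp add: fun_eq_iff Kmat_eq partial_prod_atMost Mmat_def)
  ultimately show ?thesis
    unfolding monodromy_factor.factor_form_def[OF monodromy_factor_at[OF assms]]
    by (simp add: omega_def omega1_def omega2_def sum.distrib sum_distrib_left)
qed

text \<open>
Logarithmic derivatives obey the chain rule, so the contribution of a puncture commutes with pullback. Closedness can
thus be checked for functions of the chart coordinates.
\<close>

lemma factor_form_pullback:
  fixes \<sigma> :: "'a::real_normed_vector \<Rightarrow> ('n::finite, 'N::{finite,linorder}) mdata"
  assumes \<sigma>: "\<sigma> differentiable (at u)" and p: "frames_invertible (\<sigma> u)"
  shows "monodromy_factor.factor_form (\<lambda>u. Cmat j (\<sigma> u)) (\<lambda>u. Lam j (\<sigma> u)) (\<lambda>u. partial_prod {..<j} (\<sigma> u)) u a b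
   = monodromy_factor.factor_form (Cmat j) (Lam j) (partial_prod {..<j}) (\<sigma> u)
      (differential \<sigma> u a) (differential \<sigma> u b)"
proof -
  note f = monodromy_factor_at[OF p]
  note c = log_diff_compose[OF \<sigma>]
  show ?thesis
    unfolding monodromy_factor.factor_form_def[OF f]
      monodromy_factor.factor_form_def[OF monodromy_factor_pullback[OF assms]] tr_wedge_def
      c[OF monodromy_factor.factor_diff(3)[OF f]] c[OF monodromy_factor.factor_diff(4)[OF f]]
      c[OF monodromy_factor.diff(1)[OF f]] c[OF monodromy_factor.diff(2)[OF f]] ..
qed

section \<open>The form on the constraint set and its behaviour under the gauge action\<close>

lemma partial_prod_atMost_fun:
  "partial_prod {..j} = (\<lambda>x. partial_prod {..<j} x ** (Cmat j x ** Lam j x ** matrix_inv (Cmat j x)))"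
  by (simp add: fun_eq_iff partial_prod_atMost Mmat_def)

lemma log_diff_partial_prod_empty:
  fixes p :: "('n::finite, 'N::{finite,linorder}) mdata"
  shows "log_diff (partial_prod {}) p v = 0" "rlog_diff (partial_prod {}) p v = 0"
proof -
  have "partial_prod {} = (\<lambda>p :: ('n, 'N) mdata. mat 1)"
    by (simp add: fun_eq_iff)
  then show "log_diff (partial_prod {}) p v = 0" "rlog_diff (partial_prod {}) p v = 0"
    by (simp_all add: log_diff_def rlog_diff_def)
qed

text \<open>
The 1-form \<open>\<gamma> = G\<inverse> dG\<close> of the moving frame \<open>G = M\<^sub>1 \<cdots> M\<^bsub>j-1\<^esub> C\<^sub>j\<close>.
\<close>

definition moving_frame_diff :: "'N \<Rightarrow> ('n::finite, 'N::{finite,linorder}) mdata \<Rightarrow> ('n, 'N) mdata \<Rightarrow> complex^'n^'n" where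
  "moving_frame_diff j = log_diff (\<lambda>x. partial_prod {..<j} x ** Cmat j x)"

text \<open>
The coefficient of \<open>C\<^sub>j\<inverse> dC\<^sub>j\<close> when the form is contracted with \<open>v\<close>.
\<close>

definition omega_frame_coeff :: "'N \<Rightarrow> ('n::finite, 'N::{finite,linorder}) mdata \<Rightarrow> ('n, 'N) mdata \<Rightarrow> complex^'n^'n" where
  "omega_frame_coeff j p v = matrix_inv (Lam j p) ** moving_frame_diff j p v ** Lam j p
     - moving_frame_diff j p v + log_diff (Lam j) p v"

text \<open>
The negated coefficient of \<open>\<Lambda>\<^sub>j\<inverse> d\<Lambda>\<^sub>j\<close> when the form is contracted with \<open>v\<close>.
\<close>

definition omega_exponent_coeff :: "'N \<Rightarrow> ('n::finite, 'N::{finite,linorder}) mdata \<Rightarrow> ('n, 'N) mdata \<Rightarrow> complex^'n^'n" where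
  "omega_exponent_coeff j p v =
     log_diff (Lam j) p v + moving_frame_diff j p v + moving_frame_diff j p v"

text \<open>
The telescoping terms of the local formula add up to \<open>tr (dK K\<inverse> \<cdot> dK K\<inverse>)\<close> for the full product, which vanishes as
soon as one of the two arguments is tangent to the constraint set. What remains is a sum over the punctures in
which \<open>w\<close> enters through its local data only.
\<close>

lemma omega_local:
  fixes p :: "('n::finite, 'N::{finite,linorder}) mdata"
  assumes p: "frames_invertible p" and v: "differential total_monodromy p v = 0"
  shows "omega p v w = 1 / (4 * of_real pi * \<i>) * (\<Sum>j\<in>UNIV.
     2 * trace (omega_frame_coeff j p v ** log_diff (Cmat j) p w)
     - trace (omega_exponent_coeff j p v ** log_diff (Lam j) p w))"
proof -
  let ?h = "\<lambda>S. trace (rlog_diff (partial_prod S) p v ** rlog_diff (partial_prod S) p w)"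
  let ?t = "\<lambda>j. 2 * trace (omega_frame_coeff j p v ** log_diff (Cmat j) p w)
     - trace (omega_exponent_coeff j p v ** log_diff (Lam j) p w)"
  have "monodromy_factor.factor_form (Cmat j) (Lam j) (partial_prod {..<j}) p v w
    = ?t j + (?h {..j} - ?h {..<j})" for j
    unfolding monodromy_factor.factor_form_half[OF monodromy_factor_at[OF p]]
      omega_frame_coeff_def omega_exponent_coeff_def moving_frame_diff_def partial_prod_atMost_fun
    by simp
  then have "(\<Sum>j\<in>UNIV. monodromy_factor.factor_form (Cmat j) (Lam j) (partial_prod {..<j}) p v w)
    = (\<Sum>j\<in>UNIV. ?t j) + (?h UNIV - ?h {})"
    using sum_telescope_linorder[of UNIV ?h] by (simp add: sum.distrib)
  moreover have "rlog_diff (partial_prod UNIV) p v = 0"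
    using v by (simp add: rlog_diff_def total_eq)
  ultimately show ?thesis
    by (simp add: omega_eq_factor_forms[OF p] log_diff_partial_prod_empty trace_zero)
qed

lemma log_diff_add:
  assumes "F differentiable (at p)"
  shows "log_diff F p (v + w) = log_diff F p v + log_diff F p w"
    "log_diff F p (- v) = - log_diff F p v"
  using linear_frechet_derivative[OF assms]
  by (simp_all add: log_diff_def linear_add linear_neg matrix_add_ldistrib matrix_mult.minus_right)

lemma omega_antisym:
  fixes p :: "('n::finite, 'N::{finite,linorder}) mdata"
  shows "omega p v w = - omega p w v"
proof -
  have "tr_wedge \<alpha> \<beta> v w = - tr_wedge \<alpha> \<beta> w v" for \<alpha> \<beta> :: "_ \<Rightarrow> complex^'n^'n"
    by (simp add: tr_wedge_def)
  then show ?thesis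
    unfolding omega_def omega1_def omega2_def by (simp add: sum_negf algebra_simps)
qed

lemma omega_add_left:
  fixes p :: "('n::finite, 'N::{finite,linorder}) mdata"
  assumes p: "frames_invertible p"
  shows "omega p (v + v') w = omega p v w + omega p v' w"
proof -
  have d: "Kmat j differentiable (at p)" for j
    by (simp add: Kmat_eq partial_prod_differentiable p)
  show ?thesis
    unfolding omega_def omega1_def omega2_def tr_wedge_def
      log_diff_add[OF Mmat_differentiable[OF p]] log_diff_add[OF d]
      log_diff_add[OF Lam_differentiable] log_diff_add[OF Cmat_differentiable]
    by (simp only: trace_expand sum.distrib) (simp add: algebra_simps sum.distrib sum_subtractf)
qed

lemma omega_add_right:
  assumes "frames_invertible p"
  shows "omega p v (w + w') = omega p v w + omega p v w'"
  using omega_add_left[OF assms, of w w' v] omega_antisym by (metis minus_add_distrib)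

lemma Cmat_inf_action: "Cmat j (inf_action X p) = X ** Cmat j p"
  by (simp add: Cmat_def inf_action_def)

lemma Lmat_inf_action: "Lmat j (inf_action X p) = 0"
  by (simp add: Lmat_def inf_action_def diag_mat_def vec_eq_iff)

lemma log_diff_inf_action_Lam: "log_diff (Lam j) p (inf_action X p) = 0"
  by (simp add: log_diff_Lam Lmat_inf_action msmult_def vec_eq_iff)

context
  fixes p :: "('n::finite, 'N::{finite,linorder}) mdata"
  assumes p: "frames_invertible p"
begin

lemma Cmat_invertible: "invertible (Cmat j p)"
  using p by (simp add: frames_invertible_def)

lemma log_diff_inf_action_Mmat:
  "log_diff (Mmat j) p (inf_action X p) = matrix_inv (Mmat j p) ** X ** Mmat j p - X"
proof -
  have "log_diff (Mmat j) p (inf_action X p) =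
    log_diff (\<lambda>x. Cmat j x ** Lam j x ** matrix_inv (Cmat j x)) p (inf_action X p)"
    by (simp add: Mmat_def[abs_def])
  also have "\<dots> = matrix_inv (Mmat j p) ** X ** Mmat j p - X"
    unfolding monodromy_factor.log_diff_M[OF monodromy_factor_at[OF p]]
    by (simp add: log_diff_inf_action_Lam log_diff_Cmat Cmat_inf_action Mmat_def matrix_inv_mult
       invertible_mult invertible_matrix_inv matrix_ring_simps matrix_inv_cancel Cmat_invertible invertible_Lam)
  finally show ?thesis .
qed

text \<open>
The monodromies, and with them their products, move by conjugation under the left action on the frames.
\<close>

lemma log_diff_inf_action_partial_prod:
  "log_diff (partial_prod S) p (inf_action X p) = matrix_inv (partial_prod S p) ** X ** partial_prod S p - X"
  using finite[of S]
proof (induction S rule: finite_linorder_max_induct)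
  case empty
  show ?case unfolding log_diff_partial_prod_empty by simp
next
  case (insert b S)
  have eq: "partial_prod (insert b S) = (\<lambda>p :: ('n, 'N) mdata. partial_prod S p ** Mmat b p)"
    using insert.hyps by (auto simp: fun_eq_iff partial_prod_insert)
  note i = invertible_partial_prod[OF p] invertible_Mmat[OF p]
  note d = partial_prod_differentiable[OF p] Mmat_differentiable[OF p]
  show ?case
    unfolding eq log_diff_mult[OF d(1) i(1) d(2) i(2)] rlog_diff_eq_conj[OF d(2) i(2)] insert.IH
      log_diff_inf_action_Mmat
    by (simp add: matrix_ring_simps matrix_inv_cancel i matrix_inv_mult)
qed

lemma moving_frame_diff_inf_action:
  "moving_frame_diff j p (inf_action X p) =
    matrix_inv (partial_prod {..<j} p ** Cmat j p) ** X ** (partial_prod {..<j} p ** Cmat j p)"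
proof -
  note i = invertible_partial_prod[OF p] Cmat_invertible
  note d = partial_prod_differentiable[OF p] Cmat_differentiable
  show ?thesis
    unfolding moving_frame_diff_def log_diff_mult[OF d(1) i(1) d(2) i(2)] rlog_diff_eq_conj[OF d(2) i(2)]
      log_diff_inf_action_partial_prod log_diff_Cmat Cmat_inf_action
    by (simp add: matrix_ring_simps matrix_inv_cancel i matrix_inv_mult)
qed

lemma differential_total_inf_action:
  assumes "total_monodromy p = mat 1"
  shows "differential total_monodromy p (inf_action X p) = 0"
  using log_diff_inf_action_partial_prod[of UNIV X] assms
  by (simp add: total_eq log_diff_def)

text \<open>
Contracting with a gauge direction gives \<open>-2 tr (X dK K\<inverse>)\<close> for the full product, which is zero on tangent vectors.
\<close>

lemma omega_inf_action:
  assumes t: "total_monodromy p = mat 1" and w: "differential total_monodromy p w = 0"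
  shows "omega p (inf_action X p) w = 0"
proof -
  let ?h = "\<lambda>S. trace (X ** rlog_diff (partial_prod S) p w)"
  have "2 * trace (omega_frame_coeff j p (inf_action X p) ** log_diff (Cmat j) p w)
     - trace (omega_exponent_coeff j p (inf_action X p) ** log_diff (Lam j) p w)
     = - 2 * (?h {..j} - ?h {..<j})" for j
    using monodromy_factor.trace_rlog_diff_step[OF monodromy_factor_at[OF p, of j]
       moving_frame_diff_inf_action, of X w]
    unfolding omega_frame_coeff_def omega_exponent_coeff_def log_diff_inf_action_Lam
      partial_prod_atMost_fun
    by (simp only: trace_expand times0_right times0_left add_0_left add_0_right trace_zero) (simp add: algebra_simps)
  then have "omega p (inf_action X p) w = 1 / (4 * of_real pi * \<i>) * (- 2 * (?h UNIV - ?h {}))"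
    unfolding omega_local[OF p differential_total_inf_action[OF t]]
    by (simp only: sum_distrib_left[symmetric] sum_telescope_linorder[of UNIV ?h] UNIV_I)
  moreover have "rlog_diff (partial_prod UNIV) p w = 0"
    using w by (simp add: rlog_diff_def total_eq)
  ultimately show ?thesis
    by (simp add: log_diff_partial_prod_empty trace_zero)
qed

lemma omega_add_inf_action:
  assumes t: "total_monodromy p = mat 1"
    and v: "differential total_monodromy p v = 0" and w: "differential total_monodromy p w = 0"
  shows "omega p (v + inf_action X p) (w + inf_action Y p) = omega p v w"
  using omega_inf_action[OF t w] omega_inf_action[OF t v] omega_antisym[of p v "inf_action Y p"]
    omega_inf_action[OF t differential_total_inf_action[OF t], of X Y]
  by (simp add: omega_add_left[OF p] omega_add_right[OF p])

end

lemma lmult_simps: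
  "Cmat j (lmult S p) = S ** Cmat j p" "Lmat j (lmult S p) = Lmat j p" "Lam j (lmult S p) = Lam j p"
  by (simp_all add: Cmat_def lmult_def Lmat_def Lam_def)

context
  fixes S :: "complex^'n^'n"
  assumes S: "invertible S"
begin

lemma frames_invertible_lmult: "frames_invertible (lmult S p) \<longleftrightarrow> frames_invertible p"
proof -
  have "invertible (S ** C) \<longleftrightarrow> invertible C" for C :: "complex^'n^'n"
    using S by (simp add: invertible_det_nz det_mul)
  then show ?thesis by (simp add: frames_invertible_def lmult_simps)
qed

context
  fixes p :: "('n, 'N::{finite,linorder}) mdata"
  assumes p: "frames_invertible p"
begin

lemma log_diff_lmult:
  "log_diff (Cmat j) (lmult S p) (lmult S v) = log_diff (Cmat j) p v"
  "log_diff (Lam j) (lmult S p) (lmult S v) = log_diff (Lam j) p v"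
  using p S by (simp_all add: log_diff_Cmat log_diff_Lam lmult_simps frames_invertible_def
      matrix_inv_mult matrix_mul_assoc[symmetric] matrix_inv_cancel)

lemma Mmat_lmult: "Mmat j (lmult S p) = S ** Mmat j p ** matrix_inv S"
  using S p by (simp add: Mmat_def lmult_simps matrix_inv_mult frames_invertible_def matrix_mul_assoc)

text \<open>
The logarithmic derivative of a monodromy is the conjugate by the frame of an expression that the action does not
change, and the action multiplies the frame by \<open>S\<close>.
\<close>

lemma log_diff_lmult_Mmat:
  "log_diff (Mmat j) (lmult S p) (lmult S v) = S ** log_diff (Mmat j) p v ** matrix_inv S"
proof -
  have "log_diff (Mmat j) q w = Cmat j q ** (matrix_inv (Lam j q) ** log_diff (Cmat j) q w ** Lam j q
      + log_diff (Lam j) q w - log_diff (Cmat j) q w) ** matrix_inv (Cmat j q)"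
    if "frames_invertible q" for q w :: "('n, 'N) mdata"
    using monodromy_factor.log_diff_M[OF monodromy_factor_at[OF that, of j]]
    by (simp add: Mmat_def[abs_def])
  from this[OF p] this[of "lmult S p" "lmult S v"] show ?thesis
    using p S by (simp only: frames_invertible_lmult log_diff_lmult lmult_simps)
      (simp add: matrix_inv_mult frames_invertible_def matrix_mul_assoc)
qed

lemma log_diff_lmult_partial_prod:
  "log_diff (partial_prod T) (lmult S p) (lmult S v) = S ** log_diff (partial_prod T) p v ** matrix_inv S"
  using finite[of T]
proof (induction T rule: finite_linorder_max_induct)
  case empty
  show ?case unfolding log_diff_partial_prod_empty by simp
next
  case (insert b T)
  have eq: "partial_prod (insert b T) = (\<lambda>p :: ('n, 'N) mdata. partial_prod T p ** Mmat b p)"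
    using insert.hyps by (auto simp: fun_eq_iff partial_prod_insert)
  have q: "frames_invertible (lmult S p)" by (simp add: frames_invertible_lmult p)
  note i = invertible_partial_prod[OF p] invertible_Mmat[OF p]
  note i' = invertible_partial_prod[OF q] invertible_Mmat[OF q]
  note d = partial_prod_differentiable[OF p] Mmat_differentiable[OF p]
  note d' = partial_prod_differentiable[OF q] Mmat_differentiable[OF q]
  show ?case
    unfolding eq log_diff_mult[OF d(1) i(1) d(2) i(2)] rlog_diff_eq_conj[OF d(2) i(2)]
      log_diff_mult[OF d'(1) i'(1) d'(2) i'(2)] rlog_diff_eq_conj[OF d'(2) i'(2)]
      insert.IH log_diff_lmult_Mmat Mmat_lmult
    by (simp add: matrix_ring_simps matrix_inv_cancel i S invertible_mult invertible_matrix_inv matrix_inv_mult)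
qed

lemma omega_lmult: "omega (lmult S p) (lmult S v) (lmult S w) = omega p v w"
  unfolding omega_def omega1_def omega2_def tr_wedge_def Kmat_eq log_diff_lmult_Mmat
    log_diff_lmult_partial_prod log_diff_lmult lmult_simps
  using S by (simp add: trace_conj_mult)

lemma differential_total_lmult:
  assumes "differential total_monodromy p v = 0"
  shows "differential total_monodromy (lmult S p) (lmult S v) = 0"
proof -
  have "matrix_inv (partial_prod UNIV (lmult S p)) ** differential total_monodromy (lmult S p) (lmult S v) = 0"
    using log_diff_lmult_partial_prod[of UNIV v] assms by (simp add: log_diff_def total_eq)
  moreover have "invertible (partial_prod UNIV (lmult S p))"
    by (simp add: invertible_partial_prod frames_invertible_lmult p)
  ultimately show ?thesis
    using matrix_inv_cancel(3)[of "partial_prod UNIV (lmult S p)"] by (metis times0_right)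
qed

end
end

lemma SL_invertible: "S \<in> SL \<Longrightarrow> invertible S"
  by (simp add: SL_def invertible_det_nz)

lemma lmult_1 [simp]: "lmult (mat 1) p = p"
  by (simp add: lmult_def)

lemma inf_action_0 [simp]: "inf_action 0 p = 0"
  by (simp add: inf_action_def zero_prod_def vec_eq_iff)

lemma mem_dproj: "(p, v) \<in> dproj p v"
proof -
  have "mat 1 \<in> SL" "0 \<in> sl" by (simp_all add: SL_def sl_def trace_zero)
  then show ?thesis unfolding dproj_def
    by (intro CollectI exI[of _ "mat 1"] exI[of _ 0]) simp
qed

lemma dproj_eqD:
  assumes "dproj p v = dproj q w"
  obtains S X where "S \<in> SL" "X \<in> sl" "p = lmult S q" "v = lmult S w + inf_action X p"
  using mem_dproj[of p v] unfolding assms by (auto simp: dproj_def)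

lemma constraint_set_frames: "p \<in> constraint_set \<Longrightarrow> frames_invertible p"
  by (auto simp: constraint_set_def frames_invertible_def SL_invertible)

lemma lmult_cancel:
  assumes "frames_invertible p" "lmult S p = lmult T p"
  shows "S = T"
proof -
  fix j
  have "invertible (Cmat j p)" using assms(1) by (simp add: frames_invertible_def)
  moreover have "S ** Cmat j p = T ** Cmat j p" using assms(2) by (metis lmult_simps(1))
  ultimately show "S = T"
    by (metis matrix_inv_cancel(1) matrix_mul_assoc matrix_mul_rid)
qed

text \<open>
Two representatives of a pair of tangent vectors differ by an element of the tangent group for each vector.
The group parts coincide because the action is free; the Lie algebra parts may differ, but they are in the
radical.
\<close>

lemma omega_well_defined:
  fixes p q :: "('n::finite, 'N::{finite,linorder}) mdata"
  assumes p: "p \<in> constraint_set" and q: "q \<in> constraint_set"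
    and v': "v' \<in> constraint_tangent q" and w': "w' \<in> constraint_tangent q"
    and v: "dproj p v = dproj q v'" and w: "dproj p w = dproj q w'"
  shows "omega p v w = omega q v' w'"
proof -
  obtain S X where S: "S \<in> SL" "p = lmult S q" "v = lmult S v' + inf_action X p"
    using dproj_eqD[OF v] by blast
  obtain T Y where T: "p = lmult T q" "w = lmult T w' + inf_action Y p"
    using dproj_eqD[OF w] by blast
  note fq = constraint_set_frames[OF q] and fp = constraint_set_frames[OF p]
  have "S = T" using lmult_cancel[OF fq] S T by metis
  note d = differential_total_lmult[OF SL_invertible[OF S(1)] fq]
  have "omega p v w = omega p (lmult S v' + inf_action X p) (lmult S w' + inf_action Y p)"
    using S T \<open>S = T\<close> by metis
  also have "\<dots> = omega p (lmult S v') (lmult S w')"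
    by (rule omega_add_inf_action[OF fp])
      (use p d v' w' S in \<open>auto simp: constraint_set_def constraint_tangent_def\<close>)
  also have "\<dots> = omega q v' w'"
    unfolding S(2) by (rule omega_lmult[OF SL_invertible[OF S(1)] fq])
  finally show ?thesis .
qed

lemma descends_to_omega_M: "descends_to omega (omega_M :: ('n::finite, 'N::{finite,linorder}) mform)"
  unfolding descends_to_def omega_M_def
  by (intro ballI the_equality) (use omega_well_defined in \<open>blast+\<close>)

lemma constraint_tangent_gauge:
  fixes p :: "('n::finite, 'N::{finite,linorder}) mdata"
  assumes p: "p \<in> constraint_set" and q: "lmult S p \<in> constraint_set" and S: "S \<in> SL" and X: "X \<in> sl"
    and v: "v \<in> constraint_tangent p"
  shows "lmult S v + inf_action X (lmult S p) \<in> constraint_tangent (lmult S p)"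
proof -
  note fp = constraint_set_frames[OF p] and fq = constraint_set_frames[OF q] and Si = SL_invertible[OF S]
  have "trace (log_diff (Cmat j) (lmult S p) (lmult S v + inf_action X (lmult S p))) = 0" for j
  proof -
    have "trace (matrix_inv (Cmat j (lmult S p)) ** (X ** Cmat j (lmult S p))) = trace X"
      using fq by (intro trace_conj) (simp add: frames_invertible_def)
    then show ?thesis
      using v X unfolding log_diff_add[OF Cmat_differentiable] log_diff_lmult[OF Si fp]
      by (simp add: log_diff_Cmat Cmat_inf_action trace_add constraint_tangent_def sl_def)
  qed
  moreover have "Lmat j (lmult S v + inf_action X (lmult S p)) = Lmat j v" for j
    by (simp add: Lmat_def lmult_def inf_action_def)
  moreover have "differential total_monodromy (lmult S p) (lmult S v + inf_action X (lmult S p)) = 0"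
  proof -
    have "linear (differential total_monodromy (lmult S p))"
      by (intro linear_frechet_derivative) (simp add: total_eq partial_prod_differentiable fq)
    then show ?thesis
      using differential_total_lmult[OF Si fp, of v] differential_total_inf_action[OF fq] q v
      by (simp add: linear_add constraint_set_def constraint_tangent_def)
  qed
  ultimately show ?thesis
    using v by (simp add: constraint_tangent_def sl_def)
qed

text \<open>
A gauge direction represents the zero tangent vector: the two classes are matched by translating the Lie algebra
parameter.
\<close>

lemma dproj_inf_action:
  assumes "Y \<in> sl"
  shows "dproj p (inf_action Y p) = dproj p 0"
proof -
  have eq: "lmult S (inf_action Y p) + inf_action X (lmult S p)
      = lmult S 0 + inf_action (S ** Y ** matrix_inv S + X) (lmult S p)" if "S \<in> SL" for S X
    using SL_invertible[OF that]
    by (simp add: lmult_def inf_action_def vec_eq_iff matrix_ring_simps matrix_inv_cancel)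
  have tr: "S ** Y ** matrix_inv S \<in> sl" if "S \<in> SL" for S
    using trace_conj(1)[OF SL_invertible[OF that], of Y] assms by (simp add: sl_def matrix_mul_assoc)
  have sl_add: "A + B \<in> sl" "A - B \<in> sl" if "A \<in> sl" "B \<in> sl" for A B :: "complex^'a^'a"
    using that by (simp_all add: sl_def trace_add trace_sub)
  show ?thesis
  proof (intro equalityI subsetI)
    fix z assume "z \<in> dproj p (inf_action Y p)"
    then obtain S X where "S \<in> SL" "X \<in> sl" "z = (lmult S p, lmult S (inf_action Y p) + inf_action X (lmult S p))"
      by (auto simp: dproj_def)
    then show "z \<in> dproj p 0"
      unfolding dproj_def using eq tr sl_add by blast
  next
    fix z assume "z \<in> dproj p 0"
    then obtain S X where z: "S \<in> SL" "X \<in> sl" "z = (lmult S p, lmult S 0 + inf_action X (lmult S p))"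
      by (auto simp: dproj_def)
    then have "z = (lmult S p, lmult S (inf_action Y p) + inf_action (X - S ** Y ** matrix_inv S) (lmult S p))"
      by (simp add: eq)
    then show "z \<in> dproj p (inf_action Y p)"
      unfolding dproj_def using z tr sl_add by blast
  qed
qed

section \<open>Non-degeneracy\<close>

lemma diag_mat_mult_component:
  "(diag_mat a ** X) $ i $ j = a $ i * X $ i $ j"
  "(X ** diag_mat b) $ i $ j = X $ i $ j * b $ j"
proof -
  have "(\<Sum>k\<in>UNIV. diag_mat a $ i $ k * X $ k $ j) = (\<Sum>k\<in>UNIV. if k = i then a $ i * X $ i $ j else 0)"
    by (rule sum.cong) (auto simp: diag_mat_def)
  then show "(diag_mat a ** X) $ i $ j = a $ i * X $ i $ j"
    by (simp add: matrix_matrix_mult_def)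
  have "(\<Sum>k\<in>UNIV. X $ i $ k * diag_mat b $ k $ j) = (\<Sum>k\<in>UNIV. if k = j then X $ i $ j * b $ j else 0)"
    by (rule sum.cong) (auto simp: diag_mat_def)
  then show "(X ** diag_mat b) $ i $ j = X $ i $ j * b $ j"
    by (simp add: matrix_matrix_mult_def)
qed

lemma diag_mat_zero: "diag_mat 0 = 0"
  by (simp add: diag_mat_def vec_eq_iff)

lemma trace_diag_mat: "trace (diag_mat a) = (\<Sum>i\<in>UNIV. a $ i)"
  by (simp add: trace_def diag_mat_def)

definition eigenvalue :: "'N \<Rightarrow> ('n::finite, 'N::finite) mdata \<Rightarrow> 'n \<Rightarrow> complex" where
  "eigenvalue j p i = exp (2 * of_real pi * \<i> * snd p $ j $ i)"

lemma eigenvalue_nonzero [simp]: "eigenvalue j p i \<noteq> 0"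
  by (simp add: eigenvalue_def)

lemma Lam_eigenvalue:
  "Lam j p = diag_mat (\<chi> i. eigenvalue j p i)"
  "matrix_inv (Lam j p) = diag_mat (\<chi> i. 1 / eigenvalue j p i)"
proof -
  show 1: "Lam j p = diag_mat (\<chi> i. eigenvalue j p i)" by (simp add: Lam_eq eigenvalue_def)
  have "diag_mat (\<chi> i. eigenvalue j p i) ** diag_mat (\<chi> i. 1 / eigenvalue j p i) = mat 1"
    by (simp add: diag_mat_mult) (simp add: diag_mat_def mat_def vec_eq_iff)
  then show "matrix_inv (Lam j p) = diag_mat (\<chi> i. 1 / eigenvalue j p i)"
    unfolding 1 by (rule matrix_inv_eqI)
qed

lemma Lam_conj_component:
  "(matrix_inv (Lam j p) ** X ** Lam j p) $ a $ b = X $ a $ b * (eigenvalue j p b / eigenvalue j p a)"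
  "(Lam j p ** X ** matrix_inv (Lam j p)) $ a $ b = X $ a $ b * (eigenvalue j p a / eigenvalue j p b)"
  unfolding Lam_eigenvalue(2) unfolding Lam_eigenvalue(1) by (simp_all add: diag_mat_mult_component)

text \<open>
Non-resonance: exponents that differ by a non-integer have different exponentials.
\<close>

lemma eigenvalue_distinct:
  assumes "p \<in> constraint_set" "a \<noteq> b"
  shows "eigenvalue j p a \<noteq> eigenvalue j p b"
proof
  assume "eigenvalue j p a = eigenvalue j p b"
  then obtain n :: int where
    "2 * of_real pi * \<i> * snd p $ j $ a = 2 * of_real pi * \<i> * snd p $ j $ b + (of_int (2 * n) * pi) * \<i>"
    unfolding eigenvalue_def exp_eq by blast
  then have "2 * of_real pi * \<i> * (snd p $ j $ a - snd p $ j $ b) = 2 * of_real pi * \<i> * of_int n"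
    by (simp add: algebra_simps)
  then have "snd p $ j $ a - snd p $ j $ b \<in> \<int>" by simp
  moreover have "Lmat j p \<in> h_ss_nr" using assms(1) by (simp add: constraint_set_def)
  ultimately show False
    using assms(2) by (auto simp: h_ss_nr_def Lmat_def diag_mat_def)
qed

lemma trace_adjoint: "trace (\<chi> a b. cnj (H $ b $ a)) = cnj (trace H)"
  by (simp add: trace_def)

text \<open>
The trace of \<open>H H\<^sup>*\<close> is the squared Hilbert-Schmidt norm of \<open>H\<close>. This turns the vanishing of a trace functional into
the vanishing of its matrix, by testing with the adjoint.
\<close>

lemma trace_adjoint_zero:
  fixes H :: "complex^'n^'n"
  assumes "trace (H ** (\<chi> a b. cnj (H $ b $ a))) = 0"
  shows "H = 0"
proof -
  have "trace (H ** (\<chi> a b. cnj (H $ b $ a))) = of_real (\<Sum>a\<in>UNIV. \<Sum>b\<in>UNIV. (cmod (H $ a $ b))\<^sup>2)"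
    by (simp add: trace_def matrix_matrix_mult_def complex_norm_square[symmetric])
  then have "(\<Sum>a\<in>UNIV. \<Sum>b\<in>UNIV. (cmod (H $ a $ b))\<^sup>2) = 0"
    using assms by (metis of_real_eq_0_iff)
  then show ?thesis by (simp add: sum_nonneg_eq_0_iff sum_nonneg vec_eq_iff)
qed

lemma trace_conj_Lam: "trace (matrix_inv (Lam j p) ** X ** Lam j p) = trace X"
    "trace (Lam j p ** X ** matrix_inv (Lam j p)) = trace X"
  by (simp_all add: trace_def Lam_conj_component)

text \<open>
The exponents produce the diagonal of \<open>Y\<close> and the frame its off-diagonal part; the latter requires division by
\<open>1 - \<lambda>\<^sub>a / \<lambda>\<^sub>b\<close>, hence distinct eigenvalues. This is the submersion property of \<open>(C, L) \<mapsto> C e\<^bsup>2\<pi>iL\<^esup> C\<inverse>\<close>.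
\<close>

lemma factor_tangent_surjective:
  fixes p :: "('n::finite, 'N::{finite,linorder}) mdata"
  assumes p: "p \<in> constraint_set" and Y: "trace Y = 0"
  obtains B e where "trace B = 0" "(\<Sum>i\<in>UNIV. e $ i) = 0"
    "diag_mat e - Lam j p ** B ** matrix_inv (Lam j p) + B = Y"
proof
  define r where "r a b = eigenvalue j p a / eigenvalue j p b" for a b
  let ?B = "\<chi> a b. if a = b then 0 else Y $ a $ b / (1 - r a b)"
  let ?e = "\<chi> a. Y $ a $ a"
  show "trace ?B = 0" "(\<Sum>i\<in>UNIV. ?e $ i) = 0" using Y by (simp_all add: trace_def)
  have "Y $ a $ b / (1 - r a b) - Y $ a $ b / (1 - r a b) * r a b = Y $ a $ b" if "a \<noteq> b" for a b
  proof -
    have "Y $ a $ b / (1 - r a b) - Y $ a $ b / (1 - r a b) * r a b = Y $ a $ b / (1 - r a b) * (1 - r a b)"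
      by (simp only: right_diff_distrib mult_1_right)
    then show ?thesis using eigenvalue_distinct[OF p that, of j] by (simp add: r_def)
  qed
  then show "diag_mat ?e - Lam j p ** ?B ** matrix_inv (Lam j p) + ?B = Y"
    by (auto simp: vec_eq_iff Lam_conj_component r_def[symmetric] diag_mat_def)
qed

context
  fixes p :: "('n::finite, 'N::{finite,linorder}) mdata"
  assumes p: "p \<in> constraint_set"
begin

lemma frames: "frames_invertible p" "invertible (Cmat j p)" "invertible (partial_prod {..<j} p)"
    "invertible (partial_prod {..<j} p ** Cmat j p)"
  using constraint_set_frames[OF p] by (auto simp: frames_invertible_def invertible_partial_prod intro!: invertible_mult)

abbreviation "frame j \<equiv> partial_prod {..<j} p ** Cmat j p"

lemmas factor = monodromy_factor_at[OF frames(1)]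

lemma rlog_diff_total:
  "rlog_diff (partial_prod UNIV) p w = (\<Sum>j\<in>UNIV. frame j ** (log_diff (Lam j) p w
     - Lam j p ** log_diff (Cmat j) p w ** matrix_inv (Lam j p) + log_diff (Cmat j) p w) ** matrix_inv (frame j))"
proof -
  have "(\<Sum>j\<in>UNIV. rlog_diff (partial_prod {..j}) p w - rlog_diff (partial_prod {..<j}) p w)
    = rlog_diff (partial_prod UNIV) p w"
    using sum_telescope_linorder[of UNIV "\<lambda>S. rlog_diff (partial_prod S) p w"]
    by (simp add: log_diff_partial_prod_empty)
  then show ?thesis
    unfolding partial_prod_atMost_fun monodromy_factor.rlog_diff_step[OF factor] by simp
qed

text \<open>
The traceless values of \<open>C\<inverse> dC\<close> and \<open>\<Lambda>\<inverse> d\<Lambda>\<close> are coordinates on the tangent space, subject to a single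
linear equation: the increments of \<open>dK K\<inverse>\<close> must add up to zero.
\<close>

lemma tangent_with_coordinates:
  fixes B :: "'N \<Rightarrow> complex^'n^'n" and e :: "'N \<Rightarrow> complex^'n"
  assumes "\<And>j. trace (B j) = 0" "\<And>j. (\<Sum>i\<in>UNIV. e j $ i) = 0"
    and "(\<Sum>j\<in>UNIV. frame j ** (diag_mat (e j) - Lam j p ** B j ** matrix_inv (Lam j p) + B j)
      ** matrix_inv (frame j)) = 0"
  obtains w where "w \<in> constraint_tangent p" "\<And>j. log_diff (Cmat j) p w = B j"
    "\<And>j. log_diff (Lam j) p w = diag_mat (e j)"
proof
  let ?w = "((\<chi> j. Cmat j p ** B j), (\<chi> j i. e j $ i / (2 * of_real pi * \<i>))) :: ('n, 'N) mdata"
  show C: "log_diff (Cmat j) p ?w = B j" for j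
    by (simp add: log_diff_Cmat) (simp add: Cmat_def matrix_inv_cancel frames[unfolded Cmat_def])
  show L: "log_diff (Lam j) p ?w = diag_mat (e j)" for j
    by (simp add: log_diff_Lam Lmat_def msmult_diag_mat)
  have "rlog_diff (partial_prod UNIV) p ?w = 0"
    unfolding rlog_diff_total C L using assms(3) .
  then have "differential total_monodromy p ?w = 0"
    using p by (simp add: rlog_diff_def total_eq constraint_set_def)
  moreover have "trace (Lmat j ?w) = 0" for j
    using assms(2)[of j] by (simp add: Lmat_def trace_diag_mat sum_divide_distrib[symmetric])
  ultimately show "?w \<in> constraint_tangent p"
    using assms(1) C by (simp add: constraint_tangent_def sl_def)
qed

text \<open>
The logarithmic derivatives of the partial products are traceless by telescoping, since those of the single
monodromies are.
\<close>

lemma trace_moving_frame_diff: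
  assumes C: "\<And>j. trace (log_diff (Cmat j) p v) = 0" and L: "\<And>j. trace (log_diff (Lam j) p v) = 0"
  shows "trace (moving_frame_diff j p v) = 0"
proof -
  let ?h = "\<lambda>S. trace (log_diff (partial_prod S) p v)"
  have cancel: "trace (Cmat i p ** X ** matrix_inv (Cmat i p)) = trace X" for X i
    using trace_conj(1)[OF frames(2)] by (simp add: matrix_mul_assoc)
  have "?h {..i} - ?h {..<i} = 0" for i
    unfolding partial_prod_atMost_fun monodromy_factor.log_diff_N[OF factor]
      monodromy_factor.log_diff_K[OF factor] cancel
    using L by (simp add: trace_add trace_sub trace_conj_Lam)
  then have "?h {..<j} = 0"
    using sum_telescope_linorder[of "{..<j}" ?h] by (simp add: log_diff_partial_prod_empty trace_zero)
  then show ?thesis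
    unfolding monodromy_factor.log_diff_K[OF factor] cancel moving_frame_diff_def
    using C by (simp add: trace_sub)
qed

text \<open>
Testing with the adjoint of the frame coefficient \<open>\<Lambda>\<inverse> \<gamma> \<Lambda> - \<gamma> + D\<close> shows that it is zero. On the diagonal it equals \<open>D\<close>,
and off the diagonal it is \<open>\<gamma>\<close> times a factor that is nonzero by non-resonance; so \<open>D = 0\<close> and \<open>\<gamma>\<close> is diagonal. Then the
exponent coefficient is \<open>2 \<gamma>\<close>, and testing it with the adjoint of \<open>\<gamma>\<close> kills \<open>\<gamma>\<close>.
\<close>

lemma omega_coefficients_zero:
  assumes D: "trace (log_diff (Lam j) p v) = 0" and g: "trace (moving_frame_diff j p v) = 0"
    and Ld: "log_diff (Lam j) p v = diag_mat d"
    and zero: "\<And>B e. trace B = 0 \<Longrightarrow> (\<Sum>i\<in>UNIV. e $ i) = 0 \<Longrightarrow>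
      2 * trace (omega_frame_coeff j p v ** B) - trace (omega_exponent_coeff j p v ** diag_mat e) = 0"
  shows "moving_frame_diff j p v = 0 \<and> log_diff (Lam j) p v = 0"
proof -
  let ?H = "omega_frame_coeff j p v" and ?g = "moving_frame_diff j p v"
  have "trace ?H = 0"
    using D by (simp add: omega_frame_coeff_def trace_add trace_sub trace_conj_Lam)
  then have "trace (\<chi> a b. cnj (?H $ b $ a)) = 0"
    by (simp add: trace_adjoint)
  from zero[OF this, of 0] have H: "?H = 0"
    by (intro trace_adjoint_zero) (simp add: diag_mat_zero trace_zero)
  have Hc: "?g $ a $ b * (eigenvalue j p b / eigenvalue j p a) - ?g $ a $ b + diag_mat d $ a $ b = 0" for a b
  proof -
    have "?H $ a $ b = 0" by (simp add: H)
    then show ?thesis by (simp add: omega_frame_coeff_def Lam_conj_component Ld)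
  qed
  have "d $ a = 0" for a using Hc[of a a] by (simp add: diag_mat_def)
  then have D0: "log_diff (Lam j) p v = 0" by (simp add: Ld diag_mat_def vec_eq_iff)
  have off: "?g $ a $ b = 0" if "a \<noteq> b" for a b
  proof -
    have "?g $ a $ b * (eigenvalue j p b / eigenvalue j p a - 1) = 0"
      using Hc[of a b] that by (simp add: diag_mat_def algebra_simps)
    moreover have "eigenvalue j p b / eigenvalue j p a \<noteq> 1"
      using eigenvalue_distinct[OF p that, of j] by auto
    ultimately show ?thesis by simp
  qed
  define e where "e = (\<chi> a. cnj (?g $ a $ a))"
  have adj: "diag_mat e = (\<chi> a b. cnj (?g $ b $ a))"
    using off by (auto simp: vec_eq_iff diag_mat_def e_def)
  have "(\<Sum>i\<in>UNIV. e $ i) = 0"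
    using g by (simp add: e_def trace_def flip: cnj_sum)
  from zero[OF _ this, of 0] have "trace (?g ** diag_mat e) = 0"
    unfolding omega_exponent_coeff_def D0 H by (simp only: matrix_mult.add_left trace_add) (simp add: trace_zero)
  then have "?g = 0" unfolding adj by (rule trace_adjoint_zero)
  with D0 show ?thesis by simp
qed

text \<open>
With \<open>\<gamma> = 0\<close> and \<open>D = 0\<close>, both \<open>K\<close> and \<open>N\<close> have logarithmic derivative \<open>- dC C\<inverse>\<close>. So this value does not change from
puncture to puncture; it starts at the empty product, where it is zero.
\<close>

lemma moving_frames_constant:
  assumes g: "\<And>j. moving_frame_diff j p v = 0" and D: "\<And>j. log_diff (Lam j) p v = 0"
  shows "v = 0"
proof -
  have K: "log_diff (partial_prod {..<j}) p v = Cmat j p ** (- log_diff (Cmat j) p v) ** matrix_inv (Cmat j p)" for j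
    unfolding monodromy_factor.log_diff_K[OF factor] g[unfolded moving_frame_diff_def] by simp
  have "log_diff (partial_prod {..j}) p v = Cmat j p ** (- log_diff (Cmat j) p v) ** matrix_inv (Cmat j p)" for j
    unfolding partial_prod_atMost_fun monodromy_factor.log_diff_N[OF factor] D g[unfolded moving_frame_diff_def]
    by simp
  with K have "log_diff (partial_prod {..<j}) p v = 0" for j
    using sum_telescope_linorder[of "{..<j}" "\<lambda>S. log_diff (partial_prod S) p v"]
    by (simp add: log_diff_partial_prod_empty)
  with K have "Cmat j p ** (- (log_diff (Cmat j) p v)) ** matrix_inv (Cmat j p) ** Cmat j p = 0" for j
    by simp
  then have "Cmat j v = 0" for j
    by (simp add: log_diff_Cmat matrix_ring_simps matrix_inv_cancel frames)
  moreover have "snd v $ j $ i = 0" for j i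
  proof -
    have "log_diff (Lam j) p v $ i $ i = 0" by (simp add: D)
    then show ?thesis by (simp add: log_diff_Lam Lmat_def msmult_def diag_mat_def)
  qed
  ultimately show ?thesis
    by (simp add: Cmat_def prod_eq_iff vec_eq_iff)
qed

text \<open>
A gauge direction corrects the radical vector so that its \<open>\<gamma>\<close> vanishes at one puncture. This puncture then absorbs
the constraint on the test vectors, and their data at every other puncture are free.
\<close>

lemma omega_radical:
  assumes v: "v \<in> constraint_tangent p"
    and rad: "\<And>w. w \<in> constraint_tangent p \<Longrightarrow> omega p v w = 0"
  obtains X where "X \<in> sl" "v = inf_action X p"
proof -
  \<comment> \<open>The puncture at which the gauge is fixed and the constraint on test vectors is met.\<close>
  obtain j0 :: 'N where True by simp
  define X where "X = frame j0 ** moving_frame_diff j0 p v ** matrix_inv (frame j0)"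
  define u where "u = v + - inf_action X p"
  have t: "total_monodromy p = mat 1" using p by (simp add: constraint_set_def)
  have dX: "differential total_monodromy p (inf_action Z p) = 0" for Z
    by (rule differential_total_inf_action[OF frames(1) t])
  have lin: "linear (differential total_monodromy p)"
    by (intro linear_frechet_derivative) (simp add: total_eq partial_prod_differentiable frames)
  have dv: "differential total_monodromy p v = 0" using v by (simp add: constraint_tangent_def)
  have du: "differential total_monodromy p u = 0"
    unfolding u_def using lin dv dX by (simp add: linear_diff)
  have urad: "omega p u w = 0" if "w \<in> constraint_tangent p" for w
  proof -
    have "omega p v w = omega p (u + inf_action X p) w" by (simp add: u_def)
    also have "\<dots> = omega p u w"
      using omega_inf_action[OF frames(1) t] that
      by (simp add: omega_add_left[OF frames(1)] constraint_tangent_def)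
    finally show ?thesis using rad[OF that] by simp
  qed
  have trC: "trace (log_diff (Cmat j) p v) = 0" for j
    using v by (simp add: constraint_tangent_def sl_def)
  have trL: "trace (log_diff (Lam j) p v) = 0" for j
  proof -
    have "trace (msmult c (Lmat j v)) = c * trace (Lmat j v)" for c
      by (simp add: trace_def msmult_def sum_distrib_left)
    then show ?thesis using v by (simp add: log_diff_Lam constraint_tangent_def)
  qed
  have X: "X \<in> sl"
    using trace_moving_frame_diff[OF trC trL, of j0] trace_conj(1)[OF frames(4)]
    by (simp add: X_def sl_def matrix_mul_assoc)
  have dG: "(\<lambda>x. partial_prod {..<j} x ** Cmat j x) differentiable (at p)" for j
    by (intro differentiable_matrix_mult partial_prod_differentiable frames Cmat_differentiable)
  have uC: "log_diff (Cmat j) p u = log_diff (Cmat j) p v - matrix_inv (Cmat j p) ** X ** Cmat j p" for j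
    unfolding u_def log_diff_add[OF Cmat_differentiable] by (simp add: log_diff_Cmat Cmat_inf_action matrix_mul_assoc)
  have uL: "log_diff (Lam j) p u = log_diff (Lam j) p v" for j
    unfolding u_def log_diff_add[OF Lam_differentiable] log_diff_inf_action_Lam by simp
  have ug: "moving_frame_diff j0 p u = 0"
  proof -
    have "moving_frame_diff j0 p u = moving_frame_diff j0 p v - moving_frame_diff j0 p (inf_action X p)"
      unfolding u_def moving_frame_diff_def log_diff_add[OF dG] by simp
    then show ?thesis
      unfolding moving_frame_diff_inf_action[OF frames(1)] X_def
      using matrix_inv_cancel[OF frames(4), of j0] by (simp add: matrix_mul_assoc[symmetric])
  qed
  have utrC: "trace (log_diff (Cmat j) p u) = 0" for j
    using trC X trace_conj(2)[OF frames(2), of j X] by (simp add: uC trace_sub sl_def matrix_mul_assoc)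
  have utrg: "trace (moving_frame_diff j p u) = 0" for j
    by (rule trace_moving_frame_diff) (simp_all add: utrC uL trL)
  define f where "f j B E = 2 * trace (omega_frame_coeff j p u ** B) - trace (omega_exponent_coeff j p u ** E)" for j B E
  have f0: "f j 0 0 = 0" for j by (simp add: f_def trace_zero)
  have omega_f: "omega p u w = 1 / (4 * of_real pi * \<i>) *
      (\<Sum>j\<in>UNIV. f j (log_diff (Cmat j) p w) (log_diff (Lam j) p w))" for w
    unfolding omega_local[OF frames(1) du] f_def ..
  have sum_f: "(\<Sum>j\<in>UNIV. f j (B j) (diag_mat (e j))) = 0"
    if admissible: "\<And>j. trace (B j) = 0" "\<And>j. (\<Sum>i\<in>UNIV. e j $ i) = 0"
      "(\<Sum>j\<in>UNIV. frame j ** (diag_mat (e j) - Lam j p ** B j ** matrix_inv (Lam j p) + B j)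
      ** matrix_inv (frame j)) = 0" for B :: "'N \<Rightarrow> complex^'n^'n" and e :: "'N \<Rightarrow> complex^'n"
  proof -
    obtain w where w: "w \<in> constraint_tangent p" "\<And>j. log_diff (Cmat j) p w = B j"
      "\<And>j. log_diff (Lam j) p w = diag_mat (e j)"
      using tangent_with_coordinates[OF admissible] by blast
    show ?thesis using urad[OF w(1)] by (simp add: omega_f w)
  qed
  have uLd: "log_diff (Lam j) p u = diag_mat (\<chi> i. 2 * of_real pi * \<i> * snd v $ j $ i)" for j
    by (subst uL) (simp add: log_diff_Lam Lmat_def msmult_diag_mat)
  \<comment> \<open>A diagonal variation of the frame commutes with \<open>\<Lambda>\<close>, so it moves no monodromy and is admissible
    at \<open>j0\<close> without compensation.\<close>
  have D0: "log_diff (Lam j0) p u = 0"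
  proof -
    define d where "d = (\<chi> i. 2 * of_real pi * \<i> * snd v $ j0 $ i)"
    define B where "B = diag_mat (\<chi> i. cnj (d $ i))"
    note Ld = uLd[of j0, folded d_def]
    have adj: "B = (\<chi> a b. cnj (diag_mat d $ b $ a))"
      by (auto simp: vec_eq_iff diag_mat_def B_def)
    have trB: "trace B = 0"
      unfolding adj trace_adjoint using trL[of j0] uL[of j0] Ld by simp
    have "Lam j0 p ** B ** matrix_inv (Lam j0 p) = B"
      unfolding Lam_eigenvalue(2) unfolding Lam_eigenvalue(1) B_def diag_mat_mult
      by (simp add: diag_mat_def vec_eq_iff)
    then have "(\<Sum>j\<in>UNIV. f j (if j = j0 then B else 0) (diag_mat ((\<lambda>_. 0) j))) = 0"
      by (intro sum_f) (auto simp: trB trace_zero diag_mat_zero intro!: sum.neutral)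
    moreover have "f j (if j = j0 then B else 0) (diag_mat ((\<lambda>_. 0) j)) = (if j = j0 then f j0 B 0 else 0)" for j
      by (simp add: diag_mat_zero f0)
    ultimately have "f j0 B 0 = 0" by simp
    then have "trace (diag_mat d ** B) = 0"
      by (simp add: f_def omega_frame_coeff_def ug trace_zero Ld)
    then show ?thesis
      unfolding Ld adj by (rule trace_adjoint_zero)
  qed
  have fj0: "f j0 B E = 0" for B E
    by (simp add: f_def omega_frame_coeff_def omega_exponent_coeff_def ug D0 trace_zero)
  have fj: "f j B (diag_mat e) = 0" if B: "trace B = 0" and e: "(\<Sum>i\<in>UNIV. e $ i) = 0" for j B e
  proof (cases "j = j0")
    case True then show ?thesis by (simp add: fj0)
  next
    case False
    define Y where "Y = diag_mat e - Lam j p ** B ** matrix_inv (Lam j p) + B"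
    define W where "W = frame j ** Y ** matrix_inv (frame j)"
    \<comment> \<open>The increment that has to be produced at \<open>j0\<close> to compensate the one at \<open>j\<close>.\<close>
    define Z where "Z = - (matrix_inv (frame j0) ** W ** frame j0)"
    have "trace Y = 0"
      using B e by (simp add: Y_def trace_add trace_sub trace_conj_Lam trace_diag_mat)
    then have "trace W = 0"
      using trace_conj(1)[OF frames(4), of j Y] by (simp add: W_def matrix_mul_assoc)
    then have "trace Z = 0"
      using trace_conj(2)[OF frames(4), of j0 W] by (simp add: Z_def trace_minus matrix_mul_assoc)
    from factor_tangent_surjective[OF p this, of j0]
    obtain B0 e0 where 0: "trace B0 = 0" "(\<Sum>i\<in>UNIV. e0 $ i) = 0"
      "diag_mat e0 - Lam j0 p ** B0 ** matrix_inv (Lam j0 p) + B0 = Z" .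
    let ?B = "\<lambda>i. if i = j then B else if i = j0 then B0 else 0"
    let ?e = "\<lambda>i. if i = j then e else if i = j0 then e0 else 0"
    let ?T = "\<lambda>i. frame i ** (diag_mat (?e i) - Lam i p ** ?B i ** matrix_inv (Lam i p) + ?B i)
        ** matrix_inv (frame i)"
    have W: "frame j0 ** Z ** matrix_inv (frame j0) = - W"
      unfolding Z_def matrix_mult.minus_right matrix_mult.minus_left
      by (simp only: matrix_mul_assoc[symmetric] matrix_inv_cancel[OF frames(4)])
        (simp only: matrix_mul_assoc matrix_inv_cancel[OF frames(4)] matrix_mul_lid matrix_mul_rid)
    have "(\<Sum>i\<in>UNIV. ?T i) = (\<Sum>i\<in>{j, j0}. ?T i)"
      by (rule sum.mono_neutral_right) (auto simp: diag_mat_zero)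
    also have "\<dots> = 0"
      using False W by (simp add: 0(3) Y_def[symmetric] W_def[symmetric])
    finally have "(\<Sum>i\<in>UNIV. ?T i) = 0" .
    then have "(\<Sum>i\<in>UNIV. f i (?B i) (diag_mat (?e i))) = 0"
      by (intro sum_f) (auto simp: B e 0 trace_zero)
    moreover have "f i (?B i) (diag_mat (?e i)) = (if i = j then f j B (diag_mat e) else 0)" for i
      using False by (auto simp: fj0 diag_mat_zero f0)
    ultimately show ?thesis by simp
  qed
  have "moving_frame_diff j p u = 0 \<and> log_diff (Lam j) p u = 0" for j
  proof (rule omega_coefficients_zero[OF _ utrg uLd])
    show "trace (log_diff (Lam j) p u) = 0" by (subst uL) (rule trL)
    show "2 * trace (omega_frame_coeff j p u ** B) - trace (omega_exponent_coeff j p u ** diag_mat e) = 0"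
      if "trace B = 0" "(\<Sum>i\<in>UNIV. e $ i) = 0" for B e
      using fj[OF that] by (simp only: f_def)
  qed
  then have "u = 0" using moving_frames_constant by blast
  then show ?thesis using that[OF X] by (simp add: u_def)
qed

end

lemma nondegenerate_omega_M: "nondegenerate_form (omega_M :: ('n::finite, 'N::{finite,linorder}) mform)"
  unfolding nondegenerate_form_def
proof (intro ballI impI)
  fix x :: "('n, 'N) mdata set" and \<xi> :: "('n, 'N) mtangent"
  assume x: "x \<in> monodromy_manifold" and \<xi>: "\<xi> \<in> tangent_space x"
    and zero: "\<forall>\<zeta>\<in>tangent_space x. omega_M \<xi> \<zeta> = 0"
  obtain p v where pv: "\<xi> = dproj p v" "p \<in> x" "v \<in> constraint_tangent p"
    using \<xi> by (auto simp: tangent_space_def)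
  have p: "p \<in> constraint_set"
    using x pv(2) by (auto simp: monodromy_manifold_def gauge_rel_def elim!: quotientE)
  have "omega p v w = 0" if w: "w \<in> constraint_tangent p" for w
  proof -
    have "dproj p w \<in> tangent_space x" unfolding tangent_space_def using w pv(2) by blast
    then have "omega_M (dproj p v) (dproj p w) = 0" using zero pv(1) by blast
    moreover have "omega_M (dproj p v) (dproj p w) = omega p v w"
      using descends_to_omega_M p pv(3) w unfolding descends_to_def by blast
    ultimately show ?thesis by simp
  qed
  then obtain X where "X \<in> sl" "v = inf_action X p"
    using omega_radical[OF p pv(3)] by blast
  then show "\<exists>p\<in>x. \<xi> = dproj p 0"
    using pv dproj_inf_action by metis
qed

section \<open>Twice differentiable maps with symmetric second derivative\<close>

text \<open>
The mean value theorem, applied first in direction \<open>a\<close> and then in direction \<open>b\<close>. The second difference on the left is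
symmetric in \<open>a\<close> and \<open>b\<close>.
\<close>

lemma second_difference_mean_value:
  fixes g :: "'a::real_normed_vector \<Rightarrow> real"
  assumes g: "\<And>x. x \<in> ball u r \<Longrightarrow> (g has_derivative g' x) (at x)"
    and g'': "\<And>x. x \<in> ball u r \<Longrightarrow> ((\<lambda>x. g' x a) has_derivative g'' x) (at x)"
    and s: "0 < s" "s * (norm a + norm b) < r"
  obtains x where "x \<in> ball u r"
    "g (u + s *\<^sub>R a + s *\<^sub>R b) - g (u + s *\<^sub>R a) - g (u + s *\<^sub>R b) + g u = s\<^sup>2 * g'' x b"
proof -
  have ball: "u + t *\<^sub>R a + t' *\<^sub>R b \<in> ball u r" if "0 \<le> t" "t \<le> s" "0 \<le> t'" "t' \<le> s" for t t'
  proof -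
    have "norm (t *\<^sub>R a + t' *\<^sub>R b) \<le> t * norm a + t' * norm b"
      using that by (intro order_trans[OF norm_triangle_ineq]) simp
    also have "\<dots> \<le> s * norm a + s * norm b"
      using that by (intro add_mono mult_right_mono) auto
    finally show ?thesis using s by (simp add: dist_norm algebra_simps norm_minus_commute)
  qed
  have line: "((\<lambda>t. h (w + t *\<^sub>R z)) has_field_derivative h' z) (at t)"
    if "(h has_derivative h') (at (w + t *\<^sub>R z))" for h :: "'a \<Rightarrow> real" and h' w z t
  proof -
    have "((\<lambda>t. w + t *\<^sub>R z) has_derivative (\<lambda>k. k *\<^sub>R z)) (at t)"
      by (auto intro!: derivative_eq_intros)
    from has_derivative_compose[OF this that] show ?thesis
      using linear_scale[OF has_derivative_linear[OF that]]
      by (simp add: has_field_derivative_def mult_commute_abs)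
  qed
  have "\<exists>t1. 0 < t1 \<and> t1 < s \<and> (g (u + s *\<^sub>R b + s *\<^sub>R a) - g (u + s *\<^sub>R a)) - (g (u + s *\<^sub>R b + 0 *\<^sub>R a) - g (u + 0 *\<^sub>R a))
      = (s - 0) * (g' (u + s *\<^sub>R b + t1 *\<^sub>R a) a - g' (u + t1 *\<^sub>R a) a)"
  proof (rule MVT2[OF s(1)])
    fix t assume t: "0 \<le> t" "t \<le> s"
    have "u + s *\<^sub>R b + t *\<^sub>R a \<in> ball u r" "u + t *\<^sub>R a \<in> ball u r"
      using ball[of t s] ball[of t 0] t s by (simp_all add: algebra_simps)
    then show "((\<lambda>t. g (u + s *\<^sub>R b + t *\<^sub>R a) - g (u + t *\<^sub>R a)) has_field_derivative
       g' (u + s *\<^sub>R b + t *\<^sub>R a) a - g' (u + t *\<^sub>R a) a) (at t)"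
      by (intro DERIV_diff line g)
  qed
  then obtain t1 where t1: "0 < t1" "t1 < s" and 1:
    "(g (u + s *\<^sub>R b + s *\<^sub>R a) - g (u + s *\<^sub>R a)) - (g (u + s *\<^sub>R b) - g u)
      = s * (g' (u + s *\<^sub>R b + t1 *\<^sub>R a) a - g' (u + t1 *\<^sub>R a) a)" by auto
  have "\<exists>t2. 0 < t2 \<and> t2 < s \<and> g' (u + t1 *\<^sub>R a + s *\<^sub>R b) a - g' (u + t1 *\<^sub>R a + 0 *\<^sub>R b) a
      = (s - 0) * g'' (u + t1 *\<^sub>R a + t2 *\<^sub>R b) b"
  proof (rule MVT2[OF s(1)])
    fix t assume "0 \<le> t" "t \<le> s"
    then show "((\<lambda>t. g' (u + t1 *\<^sub>R a + t *\<^sub>R b) a) has_field_derivative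
       g'' (u + t1 *\<^sub>R a + t *\<^sub>R b) b) (at t)"
      using ball[of t1 t] t1 by (intro line g'') auto
  qed
  then obtain t2 where t2: "0 < t2" "t2 < s" and 2:
    "g' (u + t1 *\<^sub>R a + s *\<^sub>R b) a - g' (u + t1 *\<^sub>R a) a = s * g'' (u + t1 *\<^sub>R a + t2 *\<^sub>R b) b" by auto
  show thesis
  proof (rule that)
    show "u + t1 *\<^sub>R a + t2 *\<^sub>R b \<in> ball u r" using ball t1 t2 by simp
    show "g (u + s *\<^sub>R a + s *\<^sub>R b) - g (u + s *\<^sub>R a) - g (u + s *\<^sub>R b) + g u
      = s\<^sup>2 * g'' (u + t1 *\<^sub>R a + t2 *\<^sub>R b) b"
      using 1 2 by (simp add: algebra_simps power2_eq_square)
  qed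
qed

text \<open>
Schwarz's theorem. The two mixed derivatives, tested against their difference \<open>e\<close>, take a common value at points
arbitrarily close to \<open>u\<close>, because both compute the same second difference.
\<close>

lemma symmetric_second_derivative:
  fixes f :: "'a::real_normed_vector \<Rightarrow> 'b::real_inner"
  assumes U: "open U" "u \<in> U"
    and f: "\<And>x. x \<in> U \<Longrightarrow> (f has_derivative f' x) (at x)"
    and f'': "\<And>x a. x \<in> U \<Longrightarrow> ((\<lambda>x. f' x a) has_derivative f'' x a) (at x)"
    and cont: "\<And>a b. continuous_on U (\<lambda>x. f'' x a b)"
  shows "f'' u a b = f'' u b a"
proof -
  \<comment> \<open>The mean value theorem holds for real functions, hence the inner product with a fixed vector.\<close>
  define e where "e = f'' u a b - f'' u b a"
  define H where "H a b x = f'' x a b \<bullet> e" for a b x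
  have meet: "\<exists>x\<in>ball u r. \<exists>y\<in>ball u r. H a b x = H b a y" if r: "0 < r" "ball u r \<subseteq> U" for r
  proof -
    define s where "s = r / (2 * (norm a + norm b + 1))"
    have s: "0 < s" "s * (norm a + norm b) < r" "s * (norm b + norm a) < r"
    proof -
      have n: "0 < norm a + norm b + 1" by (smt (verit) norm_ge_zero)
      then show "0 < s" using r by (simp add: s_def)
      have "s * (norm a + norm b) < s * (2 * (norm a + norm b + 1))"
        using \<open>0 < s\<close> n by (intro mult_strict_left_mono) auto
      also have "\<dots> = r" using n by (simp add: s_def)
      finally show "s * (norm a + norm b) < r" "s * (norm b + norm a) < r" by (simp_all add: add.commute)
    qed
    have g: "((\<lambda>x. f x \<bullet> e) has_derivative (\<lambda>h. f' x h \<bullet> e)) (at x)" if "x \<in> ball u r" for x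
      using f that r by (intro has_derivative_inner_left) auto
    have g'': "((\<lambda>x. f' x c \<bullet> e) has_derivative (\<lambda>h. f'' x c h \<bullet> e)) (at x)" if "x \<in> ball u r" for x c
      using f'' that r by (intro has_derivative_inner_left) auto
    obtain x where x: "x \<in> ball u r" "f (u + s *\<^sub>R a + s *\<^sub>R b) \<bullet> e - f (u + s *\<^sub>R a) \<bullet> e
       - f (u + s *\<^sub>R b) \<bullet> e + f u \<bullet> e = s\<^sup>2 * (f'' x a b \<bullet> e)"
      using second_difference_mean_value[OF g g'' s(1,2)] by blast
    obtain y where y: "y \<in> ball u r" "f (u + s *\<^sub>R b + s *\<^sub>R a) \<bullet> e - f (u + s *\<^sub>R b) \<bullet> e
       - f (u + s *\<^sub>R a) \<bullet> e + f u \<bullet> e = s\<^sup>2 * (f'' y b a \<bullet> e)"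
      using second_difference_mean_value[OF g g'' s(1,3)] by blast
    have "u + s *\<^sub>R b + s *\<^sub>R a = u + s *\<^sub>R a + s *\<^sub>R b" by (simp add: algebra_simps)
    then have comm: "f (u + s *\<^sub>R b + s *\<^sub>R a) = f (u + s *\<^sub>R a + s *\<^sub>R b)" by (rule arg_cong)
    have "s\<^sup>2 * H a b x = s\<^sup>2 * H b a y"
      unfolding H_def x(2)[symmetric] y(2)[symmetric] comm by linarith
    then have "H a b x = H b a y" using s(1) by simp
    with x(1) y(1) show ?thesis by blast
  qed
  have "H a b u = H b a u"
  proof (rule ccontr)
    assume ne: "H a b u \<noteq> H b a u"
    define d where "d = \<bar>H a b u - H b a u\<bar> / 2"
    have d: "0 < d" using ne by (simp add: d_def)
    have c: "isCont (H a b) u" for a b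
      unfolding H_def using cont[of a b] U
      by (intro continuous_intros) (simp add: continuous_on_eq_continuous_at)
    obtain r1 where r1: "r1 > 0" "\<And>x. dist x u < r1 \<Longrightarrow> dist (H a b x) (H a b u) < d"
      using c[of a b] d unfolding continuous_at_eps_delta by metis
    obtain r2 where r2: "r2 > 0" "\<And>x. dist x u < r2 \<Longrightarrow> dist (H b a x) (H b a u) < d"
      using c[of b a] d unfolding continuous_at_eps_delta by metis
    obtain r3 where r3: "r3 > 0" "ball u r3 \<subseteq> U"
      using U open_contains_ball by blast
    obtain x y where xy: "x \<in> ball u (min r1 (min r2 r3))" "y \<in> ball u (min r1 (min r2 r3))" "H a b x = H b a y"
      using meet[of "min r1 (min r2 r3)"] r1 r2 r3 by (force simp: subset_iff)
    then have "dist x u < r1" "dist y u < r2" by (simp_all add: dist_commute)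
    then have "dist (H a b x) (H a b u) < d" "dist (H b a y) (H b a u) < d"
      using r1(2) r2(2) by blast+
    then show False using xy(3) by (simp add: d_def dist_real_def abs_if split: if_splits)
  qed
  then have "e \<bullet> e = 0" by (simp add: H_def e_def inner_diff_left)
  then show ?thesis by (simp add: e_def)
qed

text \<open>
The symmetry of the second derivative is part of the notion. In this form it is inherited
by products, inverses and exponentials through the rules of differentiation, and Schwarz's theorem is needed
only once, for the chart.
\<close>

definition twice_differentiable_on ::
    "'a::real_normed_vector set \<Rightarrow> ('a \<Rightarrow> 'b::real_normed_vector) \<Rightarrow> bool" where
  "twice_differentiable_on U f \<longleftrightarrow> (\<exists>f' f''. \<forall>u\<in>U. (f has_derivative f' u) (at u) \<and>
     (\<forall>a. ((\<lambda>x. f' x a) has_derivative f'' u a) (at u)) \<and> (\<forall>a b. f'' u a b = f'' u b a))"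

lemma twice_differentiable_onI:
  assumes "\<And>u. u \<in> U \<Longrightarrow> (f has_derivative f' u) (at u)"
    and "\<And>u a. u \<in> U \<Longrightarrow> ((\<lambda>x. f' x a) has_derivative f'' u a) (at u)"
    and "\<And>u a b. u \<in> U \<Longrightarrow> f'' u a b = f'' u b a"
  shows "twice_differentiable_on U f"
  unfolding twice_differentiable_on_def using assms by blast

lemma twice_differentiable_onE:
  assumes "twice_differentiable_on U f"
  obtains f' f'' where "\<And>u. u \<in> U \<Longrightarrow> (f has_derivative f' u) (at u)"
    "\<And>u a. u \<in> U \<Longrightarrow> ((\<lambda>x. f' x a) has_derivative f'' u a) (at u)"
    "\<And>u a b. u \<in> U \<Longrightarrow> f'' u a b = f'' u b a"
  using assms unfolding twice_differentiable_on_def by metis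

lemma twice_differentiable_on_differentiable:
  "twice_differentiable_on U f \<Longrightarrow> u \<in> U \<Longrightarrow> f differentiable (at u)"
  unfolding twice_differentiable_on_def differentiable_def by blast

lemma twice_differentiable_on_linear:
  assumes L: "bounded_linear L" and f: "twice_differentiable_on U f"
  shows "twice_differentiable_on U (\<lambda>x. L (f x))"
proof -
  obtain f' f'' where d: "\<And>u. u \<in> U \<Longrightarrow> (f has_derivative f' u) (at u)"
    "\<And>u a. u \<in> U \<Longrightarrow> ((\<lambda>x. f' x a) has_derivative f'' u a) (at u)"
    "\<And>u a b. u \<in> U \<Longrightarrow> f'' u a b = f'' u b a"
    using f by (rule twice_differentiable_onE) blast
  show ?thesis
    by (rule twice_differentiable_onI[where f' = "\<lambda>u a. L (f' u a)" and f'' = "\<lambda>u a b. L (f'' u a b)"])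
      (auto intro!: bounded_linear.has_derivative[OF L] d simp: d(3))
qed

lemma twice_differentiable_on_mult:
  fixes f g :: "'a::real_normed_vector \<Rightarrow> complex^'n^'n"
  assumes f: "twice_differentiable_on U f" and g: "twice_differentiable_on U g"
  shows "twice_differentiable_on U (\<lambda>x. f x ** g x)"
proof -
  obtain f' f'' where d: "\<And>u. u \<in> U \<Longrightarrow> (f has_derivative f' u) (at u)"
    "\<And>u a. u \<in> U \<Longrightarrow> ((\<lambda>x. f' x a) has_derivative f'' u a) (at u)"
    "\<And>u a b. u \<in> U \<Longrightarrow> f'' u a b = f'' u b a"
    using f by (rule twice_differentiable_onE) blast
  obtain g' g'' where e: "\<And>u. u \<in> U \<Longrightarrow> (g has_derivative g' u) (at u)"
    "\<And>u a. u \<in> U \<Longrightarrow> ((\<lambda>x. g' x a) has_derivative g'' u a) (at u)"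
    "\<And>u a b. u \<in> U \<Longrightarrow> g'' u a b = g'' u b a"
    using g by (rule twice_differentiable_onE) blast
  show ?thesis
  proof (rule twice_differentiable_onI)
    fix u a b assume u: "u \<in> U"
    show "((\<lambda>x. f x ** g x) has_derivative (\<lambda>a. f u ** g' u a + f' u a ** g u)) (at u)"
      by (rule matrix_mult.FDERIV[OF d(1)[OF u] e(1)[OF u]])
    show "((\<lambda>x. f x ** g' x a + f' x a ** g x) has_derivative
      (\<lambda>b. (f u ** g'' u a b + f' u b ** g' u a) + (f' u a ** g' u b + f'' u a b ** g u))) (at u)"
      by (intro has_derivative_add matrix_mult.FDERIV d e u)
    show "(f u ** g'' u a b + f' u b ** g' u a) + (f' u a ** g' u b + f'' u a b ** g u)
      = (f u ** g'' u b a + f' u a ** g' u b) + (f' u b ** g' u a + f'' u b a ** g u)"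
      by (simp add: d(3)[OF u, of a b] e(3)[OF u, of a b])
  qed
qed

lemma twice_differentiable_on_matrix_inv:
  fixes f :: "'a::real_normed_vector \<Rightarrow> complex^'n^'n"
  assumes f: "twice_differentiable_on U f" and i: "\<And>u. u \<in> U \<Longrightarrow> invertible (f u)"
  shows "twice_differentiable_on U (\<lambda>x. matrix_inv (f x))"
proof -
  obtain f' f'' where d: "\<And>u. u \<in> U \<Longrightarrow> (f has_derivative f' u) (at u)"
    "\<And>u a. u \<in> U \<Longrightarrow> ((\<lambda>x. f' x a) has_derivative f'' u a) (at u)"
    "\<And>u a b. u \<in> U \<Longrightarrow> f'' u a b = f'' u b a"
    using f by (rule twice_differentiable_onE) blast
  let ?i = "\<lambda>u. matrix_inv (f u)"
  show ?thesis
  proof (rule twice_differentiable_onI)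
    fix u a b assume u: "u \<in> U"
    note di = has_derivative_matrix_inv[OF d(1)[OF u] i[OF u]]
    show "((\<lambda>x. ?i x) has_derivative (\<lambda>a. - (?i u ** f' u a ** ?i u))) (at u)" by (rule di)
    show "((\<lambda>x. - (?i x ** f' x a ** ?i x)) has_derivative
       (\<lambda>b. - (?i u ** f' u a ** (- (?i u ** f' u b ** ?i u))
          + (?i u ** f'' u a b + (- (?i u ** f' u b ** ?i u)) ** f' u a) ** ?i u))) (at u)"
      by (intro has_derivative_minus matrix_mult.FDERIV d u di)
    show "- (?i u ** f' u a ** (- (?i u ** f' u b ** ?i u))
          + (?i u ** f'' u a b + (- (?i u ** f' u b ** ?i u)) ** f' u a) ** ?i u)
       = - (?i u ** f' u b ** (- (?i u ** f' u a ** ?i u))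
          + (?i u ** f'' u b a + (- (?i u ** f' u a ** ?i u)) ** f' u b) ** ?i u)"
      by (simp add: matrix_ring_simps d(3)[OF u, of a b])
  qed
qed

lemma twice_differentiable_on_exp_diag:
  fixes l :: "'a::real_normed_vector \<Rightarrow> complex^'n"
  assumes l: "twice_differentiable_on U l"
  shows "twice_differentiable_on U (\<lambda>x. diag_mat (\<chi> i. exp (c * l x $ i)))"
proof -
  obtain l' l'' where d: "\<And>u. u \<in> U \<Longrightarrow> (l has_derivative l' u) (at u)"
    "\<And>u a. u \<in> U \<Longrightarrow> ((\<lambda>x. l' x a) has_derivative l'' u a) (at u)"
    "\<And>u a b. u \<in> U \<Longrightarrow> l'' u a b = l'' u b a"
    using l by (rule twice_differentiable_onE) blast
  let ?E = "\<lambda>u. diag_mat (\<chi> i. exp (c * l u $ i))"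
  let ?m = "\<lambda>v. diag_mat (\<chi> i. c * v $ i) :: complex^'n^'n"
  have m: "bounded_linear ?m"
    by (auto intro!: linearI simp: linear_conv_bounded_linear[symmetric] vec_eq_iff diag_mat_def algebra_simps)
  show ?thesis
  proof (rule twice_differentiable_onI)
    fix u a b assume u: "u \<in> U"
    note dE = has_derivative_exp_diag[OF d(1)[OF u]]
    show "(?E has_derivative (\<lambda>a. ?E u ** ?m (l' u a))) (at u)" by (rule dE)
    show "((\<lambda>x. ?E x ** ?m (l' x a)) has_derivative
       (\<lambda>b. ?E u ** ?m (l'' u a b) + (?E u ** ?m (l' u b)) ** ?m (l' u a))) (at u)"
      by (intro matrix_mult.FDERIV dE bounded_linear.has_derivative[OF m] d u)
    show "?E u ** ?m (l'' u a b) + (?E u ** ?m (l' u b)) ** ?m (l' u a)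
      = ?E u ** ?m (l'' u b a) + (?E u ** ?m (l' u a)) ** ?m (l' u b)"
      by (simp add: d(3)[OF u, of a b] diag_mat_mult mult_ac)
  qed
qed

lemma holomorphic_map_twice_differentiable:
  assumes U: "open U" and f: "holomorphic_map_on U f"
  shows "twice_differentiable_on U f"
proof -
  have c: "complex_Ck_on (Suc (Suc 0)) U f" using f by (simp only: holomorphic_map_on_def)
  have d1: "f differentiable (at u)" if "u \<in> U" for u
    using c that by simp
  have d2: "(\<lambda>x. differential f x a) differentiable (at u)" if "u \<in> U" for u a
    using c that by simp
  have d3: "continuous_on U (\<lambda>x. differential (\<lambda>y. differential f y a) x b)" for a b
    using c by simp
  show ?thesis
    by (rule twice_differentiable_onI[OF d1[unfolded frechet_derivative_works] d2[unfolded frechet_derivative_works]])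
      (auto intro: symmetric_second_derivative[OF U _ d1[unfolded frechet_derivative_works]
           d2[unfolded frechet_derivative_works] d3])
qed

section \<open>Closedness\<close>

text \<open>
The exterior derivative \<open>T\<close> of a 2-form on constant vector fields, together with the differentiability of all
coefficients. The relational form makes it additive without side conditions.
\<close>

definition has_ext_deriv2 :: "('v::real_normed_vector \<Rightarrow> 'v \<Rightarrow> 'v \<Rightarrow> complex) \<Rightarrow> 'v
    \<Rightarrow> ('v \<Rightarrow> 'v \<Rightarrow> 'v \<Rightarrow> complex) \<Rightarrow> bool" where
  "has_ext_deriv2 \<beta> u T \<longleftrightarrow> (\<exists>d. (\<forall>a b. ((\<lambda>x. \<beta> x a b) has_derivative d a b) (at u)) \<and>
     (\<forall>a b c. d b c a - d a c b + d a b c = T a b c))"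

lemma has_ext_deriv2I:
  assumes "\<And>a b. ((\<lambda>x. \<beta> x a b) has_derivative d a b) (at u)"
    and "\<And>a b c. d b c a - d a c b + d a b c = T a b c"
  shows "has_ext_deriv2 \<beta> u T"
  unfolding has_ext_deriv2_def using assms by blast

lemma has_ext_deriv2E:
  assumes "has_ext_deriv2 \<beta> u T"
  obtains d where "\<And>a b. ((\<lambda>x. \<beta> x a b) has_derivative d a b) (at u)"
    "\<And>a b c. d b c a - d a c b + d a b c = T a b c"
  using assms unfolding has_ext_deriv2_def by blast

lemma has_ext_deriv2_imp:
  assumes "has_ext_deriv2 \<beta> u T"
  shows "(\<lambda>x. \<beta> x a b) differentiable (at u)" "ext_deriv2 \<beta> u a b c = T a b c"
proof -
  obtain d where d: "\<And>a b. ((\<lambda>x. \<beta> x a b) has_derivative d a b) (at u)"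
    "\<And>a b c. d b c a - d a c b + d a b c = T a b c" using assms by (rule has_ext_deriv2E) blast
  show "(\<lambda>x. \<beta> x a b) differentiable (at u)"
    unfolding differentiable_def by (rule exI, rule d(1))
  show "ext_deriv2 \<beta> u a b c = T a b c"
    unfolding ext_deriv2_def frechet_derivative_at[OF d(1), symmetric] by (rule d(2))
qed

lemma has_ext_deriv2_diff:
  assumes "has_ext_deriv2 \<beta> u T" "has_ext_deriv2 \<beta>' u T'"
  shows "has_ext_deriv2 (\<lambda>x a b. \<beta> x a b - \<beta>' x a b) u (\<lambda>a b c. T a b c - T' a b c)"
proof -
  obtain d where d: "\<And>a b. ((\<lambda>x. \<beta> x a b) has_derivative d a b) (at u)"
    "\<And>a b c. d b c a - d a c b + d a b c = T a b c" using assms(1) by (rule has_ext_deriv2E) blast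
  obtain e where e: "\<And>a b. ((\<lambda>x. \<beta>' x a b) has_derivative e a b) (at u)"
    "\<And>a b c. e b c a - e a c b + e a b c = T' a b c" using assms(2) by (rule has_ext_deriv2E) blast
  show ?thesis
    by (rule has_ext_deriv2I, rule has_derivative_diff[OF d(1) e(1)])
      (simp add: d(2)[symmetric] e(2)[symmetric])
qed

lemma has_ext_deriv2_cmult_sum:
  assumes "\<And>j. j \<in> J \<Longrightarrow> has_ext_deriv2 (\<beta> j) u (T j)"
  shows "has_ext_deriv2 (\<lambda>x a b. k * (\<Sum>j\<in>J. \<beta> j x a b)) u (\<lambda>a b c. k * (\<Sum>j\<in>J. T j a b c))"
proof -
  have "\<forall>j\<in>J. \<exists>d. (\<forall>a b. ((\<lambda>x. \<beta> j x a b) has_derivative d a b) (at u)) \<and>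
     (\<forall>a b c. d b c a - d a c b + d a b c = T j a b c)"
    using assms unfolding has_ext_deriv2_def by blast
  then obtain d where d: "\<And>j a b. j \<in> J \<Longrightarrow> ((\<lambda>x. \<beta> j x a b) has_derivative d j a b) (at u)"
    "\<And>j a b c. j \<in> J \<Longrightarrow> d j b c a - d j a c b + d j a b c = T j a b c" by metis
  show ?thesis
  proof (rule has_ext_deriv2I)
    show "((\<lambda>x. k * (\<Sum>j\<in>J. \<beta> j x a b)) has_derivative (\<lambda>h. k * (\<Sum>j\<in>J. d j a b h))) (at u)" for a b
      by (intro has_derivative_mult_right has_derivative_sum d)
    show "k * (\<Sum>j\<in>J. d j b c a) - k * (\<Sum>j\<in>J. d j a c b) + k * (\<Sum>j\<in>J. d j a b c)
      = k * (\<Sum>j\<in>J. T j a b c)" for a b c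
      by (simp add: d(2)[symmetric] sum.distrib sum_subtractf algebra_simps)
  qed
qed

lemma has_ext_deriv2_transform:
  assumes "has_ext_deriv2 \<beta> u T" and U: "open U" "u \<in> U"
    and eq: "\<And>x a b. x \<in> U \<Longrightarrow> \<beta> x a b = \<beta>' x a b"
  shows "has_ext_deriv2 \<beta>' u T"
proof -
  obtain d where d: "\<And>a b. ((\<lambda>x. \<beta> x a b) has_derivative d a b) (at u)"
    "\<And>a b c. d b c a - d a c b + d a b c = T a b c" using assms(1) by (rule has_ext_deriv2E) blast
  show ?thesis
    by (rule has_ext_deriv2I[OF has_derivative_transform_within_open[OF d(1) U eq] d(2)])
qed

text \<open>
The Maurer-Cartan equation before antisymmetrization: the part \<open>s\<close> that contains second derivatives is symmetric
and disappears from every exterior derivative.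
\<close>

lemma log_diff_has_derivative:
  fixes f :: "'a::real_normed_vector \<Rightarrow> complex^'n^'n"
  assumes U: "open U" "u \<in> U" and f: "twice_differentiable_on U f" and i: "\<And>x. x \<in> U \<Longrightarrow> invertible (f x)"
  obtains s where
    "\<And>a. ((\<lambda>x. log_diff f x a) has_derivative (\<lambda>h. s a h - log_diff f u h ** log_diff f u a)) (at u)"
    "\<And>a b. s a b = s b a"
proof -
  obtain f' f'' where d: "\<And>u. u \<in> U \<Longrightarrow> (f has_derivative f' u) (at u)"
    "\<And>u a. u \<in> U \<Longrightarrow> ((\<lambda>x. f' x a) has_derivative f'' u a) (at u)"
    "\<And>u a b. u \<in> U \<Longrightarrow> f'' u a b = f'' u b a"
    using f by (rule twice_differentiable_onE) blast
  have l: "log_diff f x a = matrix_inv (f x) ** f' x a" if "x \<in> U" for x a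
    unfolding log_diff_def frechet_derivative_at[OF d(1)[OF that], symmetric] ..
  show thesis
  proof (rule that)
    fix a
    have "((\<lambda>x. matrix_inv (f x) ** f' x a) has_derivative (\<lambda>h. matrix_inv (f u) ** f'' u a h
       + (- (matrix_inv (f u) ** f' u h ** matrix_inv (f u))) ** f' u a)) (at u)"
      by (intro matrix_mult.FDERIV has_derivative_matrix_inv d i U)
    then have "((\<lambda>x. matrix_inv (f x) ** f' x a) has_derivative
       (\<lambda>h. matrix_inv (f u) ** f'' u a h - log_diff f u h ** log_diff f u a)) (at u)"
      by (simp add: l U matrix_ring_simps)
    then show "((\<lambda>x. log_diff f x a) has_derivative
       (\<lambda>h. matrix_inv (f u) ** f'' u a h - log_diff f u h ** log_diff f u a)) (at u)"
      by (rule has_derivative_transform_within_open[OF _ U]) (simp add: l)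
  next
    show "matrix_inv (f u) ** f'' u a b = matrix_inv (f u) ** f'' u b a" for a b
      by (simp add: d(3)[OF U(2), of a b])
  qed
qed

text \<open>
For \<open>dF F\<inverse>\<close> the quadratic term has the opposite order.
\<close>

lemma rlog_diff_has_derivative:
  fixes f :: "'a::real_normed_vector \<Rightarrow> complex^'n^'n"
  assumes U: "open U" "u \<in> U" and f: "twice_differentiable_on U f" and i: "\<And>x. x \<in> U \<Longrightarrow> invertible (f x)"
  obtains s where
    "\<And>a. ((\<lambda>x. rlog_diff f x a) has_derivative (\<lambda>h. s a h - rlog_diff f u a ** rlog_diff f u h)) (at u)"
    "\<And>a b. s a b = s b a"
proof -
  obtain f' f'' where d: "\<And>u. u \<in> U \<Longrightarrow> (f has_derivative f' u) (at u)"
    "\<And>u a. u \<in> U \<Longrightarrow> ((\<lambda>x. f' x a) has_derivative f'' u a) (at u)"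
    "\<And>u a b. u \<in> U \<Longrightarrow> f'' u a b = f'' u b a"
    using f by (rule twice_differentiable_onE) blast
  have l: "rlog_diff f x a = f' x a ** matrix_inv (f x)" if "x \<in> U" for x a
    unfolding rlog_diff_def frechet_derivative_at[OF d(1)[OF that], symmetric] ..
  show thesis
  proof (rule that)
    fix a
    have "((\<lambda>x. f' x a ** matrix_inv (f x)) has_derivative (\<lambda>h.
       f' u a ** (- (matrix_inv (f u) ** f' u h ** matrix_inv (f u))) + f'' u a h ** matrix_inv (f u))) (at u)"
      by (intro matrix_mult.FDERIV has_derivative_matrix_inv d i U)
    then have "((\<lambda>x. f' x a ** matrix_inv (f x)) has_derivative
       (\<lambda>h. f'' u a h ** matrix_inv (f u) - rlog_diff f u a ** rlog_diff f u h)) (at u)"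
      by (simp add: l U matrix_ring_simps)
    then show "((\<lambda>x. rlog_diff f x a) has_derivative
       (\<lambda>h. f'' u a h ** matrix_inv (f u) - rlog_diff f u a ** rlog_diff f u h)) (at u)"
      by (rule has_derivative_transform_within_open[OF _ U]) (simp add: l)
  next
    show "f'' u a b ** matrix_inv (f u) = f'' u b a ** matrix_inv (f u)" for a b
      by (simp add: d(3)[OF U(2), of a b])
  qed
qed

text \<open>
The Cartan 3-form \<open>tr (\<alpha> \<and> [\<alpha>, \<alpha>])\<close> of a matrix-valued 1-form, up to a numerical factor.
\<close>

definition cubic_form :: "('a \<Rightarrow> complex^'n^'n) \<Rightarrow> 'a \<Rightarrow> 'a \<Rightarrow> 'a \<Rightarrow> complex" where
  "cubic_form \<alpha> a b c = trace (\<alpha> a ** (\<alpha> b ** \<alpha> c - \<alpha> c ** \<alpha> b))"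

definition cartan_form :: "('a::real_normed_vector \<Rightarrow> complex^'n^'n) \<Rightarrow> 'a \<Rightarrow> 'a \<Rightarrow> 'a \<Rightarrow> 'a \<Rightarrow> complex" where
  "cartan_form f u = cubic_form (log_diff f u)"

lemma cubic_form_conj:
  assumes "invertible P"
  shows "cubic_form (\<lambda>a. matrix_inv P ** \<alpha> a ** P) a b c = cubic_form \<alpha> a b c"
    "cubic_form (\<lambda>a. P ** \<alpha> a ** matrix_inv P) a b c = cubic_form \<alpha> a b c"
proof -
  let ?X = "\<alpha> a ** (\<alpha> b ** \<alpha> c - \<alpha> c ** \<alpha> b)"
  have "matrix_inv P ** \<alpha> a ** P ** (matrix_inv P ** \<alpha> b ** P ** (matrix_inv P ** \<alpha> c ** P)
     - matrix_inv P ** \<alpha> c ** P ** (matrix_inv P ** \<alpha> b ** P)) = matrix_inv P ** (?X ** P)"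
    "P ** \<alpha> a ** matrix_inv P ** (P ** \<alpha> b ** matrix_inv P ** (P ** \<alpha> c ** matrix_inv P)
     - P ** \<alpha> c ** matrix_inv P ** (P ** \<alpha> b ** matrix_inv P)) = P ** (?X ** matrix_inv P)"
    using assms by (simp_all add: matrix_ring_simps matrix_inv_cancel)
  then show "cubic_form (\<lambda>a. matrix_inv P ** \<alpha> a ** P) a b c = cubic_form \<alpha> a b c"
    "cubic_form (\<lambda>a. P ** \<alpha> a ** matrix_inv P) a b c = cubic_form \<alpha> a b c"
    unfolding cubic_form_def by (simp_all only: trace_conj[OF assms])
qed

text \<open>
The identity \<open>dc(f, g) = \<chi>(f) + \<chi>(g) - \<chi>(f g)\<close> at one point. The mixed terms in the expansion of \<open>\<chi>\<close> at \<open>\<alpha> + \<eta>\<close> are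
exactly those which the Maurer-Cartan equations produce from \<open>tr (\<alpha> \<and> \<eta>)\<close>.
\<close>

lemma cocycle_algebra:
  fixes \<alpha> \<eta> :: "'a \<Rightarrow> complex^'n^'n"
  assumes s: "\<And>a b. s a b = s b a" and t: "\<And>a b. t a b = t b a"
    and dA: "\<And>a b. dA a b = s a b - \<alpha> b ** \<alpha> a" and dE: "\<And>a b. dE a b = t a b - \<eta> a ** \<eta> b"
    and d: "\<And>a b c. d a b c = (trace (\<alpha> a ** dE b c) + trace (dA a c ** \<eta> b))
      - (trace (\<alpha> b ** dE a c) + trace (dA b c ** \<eta> a))"
  shows "d b c a - d a c b + d a b c
    = cubic_form \<alpha> a b c + cubic_form \<eta> a b c - cubic_form (\<lambda>a. \<alpha> a + \<eta> a) a b c"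
proof -
  have cyc: "trace (\<eta> x ** (\<alpha> y ** W)) = trace (\<alpha> y ** (W ** \<eta> x))"
    "trace (\<alpha> x ** (\<eta> y ** \<alpha> z)) = trace (\<alpha> z ** (\<alpha> x ** \<eta> y))"
    "trace (\<eta> x ** (\<eta> y ** \<alpha> z)) = trace (\<alpha> z ** (\<eta> x ** \<eta> y))" for x y z W
    using trace_mul_sym[of "\<eta> x" "\<alpha> y ** W"] trace_mul_sym[of "\<alpha> x ** \<eta> y" "\<alpha> z"]
      trace_mul_sym[of "\<eta> x ** \<eta> y" "\<alpha> z"]
    by (simp_all add: matrix_mul_assoc[symmetric])
  have sym: "s b a = s a b" "s c a = s a c" "s c b = s b c"
      "t b a = t a b" "t c a = t a c" "t c b = t b c"
    by (rule s t)+
  show ?thesis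
    unfolding d dA dE cubic_form_def sym
    by (simp only: trace_expand matrix_mul_assoc[symmetric] cyc) (simp add: algebra_simps)
qed

text \<open>
Since \<open>(f g)\<inverse> d(f g)\<close> is conjugate to \<open>f\<inverse> df + dg g\<inverse>\<close>, and \<open>\<chi>\<close> is invariant under conjugation, this is the pointwise
identity for \<open>\<alpha> = f\<inverse> df\<close> and \<open>\<eta> = dg g\<inverse>\<close>.
\<close>

lemma cocycle_ext_deriv:
  fixes f g :: "'a::real_normed_vector \<Rightarrow> complex^'n^'n"
  assumes U: "open U" "u \<in> U"
    and f: "twice_differentiable_on U f" "\<And>x. x \<in> U \<Longrightarrow> invertible (f x)"
    and g: "twice_differentiable_on U g" "\<And>x. x \<in> U \<Longrightarrow> invertible (g x)"
  shows "has_ext_deriv2 (cocycle f g) u (\<lambda>a b c. cartan_form f u a b c + cartan_form g u a b c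
    - cartan_form (\<lambda>x. f x ** g x) u a b c)"
proof -
  obtain s where s: "\<And>a. ((\<lambda>x. log_diff f x a) has_derivative (\<lambda>h. s a h - log_diff f u h ** log_diff f u a)) (at u)"
    "\<And>a b. s a b = s b a" using log_diff_has_derivative[OF U f] by blast
  obtain t where t: "\<And>a. ((\<lambda>x. rlog_diff g x a) has_derivative (\<lambda>h. t a h - rlog_diff g u a ** rlog_diff g u h)) (at u)"
    "\<And>a b. t a b = t b a" using rlog_diff_has_derivative[OF U g] by blast
  note df = twice_differentiable_on_differentiable[OF f(1) U(2)] f(2)[OF U(2)]
  note dg = twice_differentiable_on_differentiable[OF g(1) U(2)] g(2)[OF U(2)]
  have cg: "cubic_form (log_diff g u) a b c = cubic_form (rlog_diff g u) a b c" for a b c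
  proof -
    have "rlog_diff g u = (\<lambda>a. g u ** log_diff g u a ** matrix_inv (g u))"
      by (simp add: fun_eq_iff rlog_diff_eq_conj[OF dg])
    then show ?thesis by (simp add: cubic_form_conj[OF dg(2)])
  qed
  have cfg: "cubic_form (log_diff (\<lambda>x. f x ** g x) u) a b c
      = cubic_form (\<lambda>a. log_diff f u a + rlog_diff g u a) a b c" for a b c
  proof -
    have "log_diff (\<lambda>x. f x ** g x) u = (\<lambda>a. matrix_inv (g u) ** (log_diff f u a + rlog_diff g u a) ** g u)"
      by (simp add: fun_eq_iff log_diff_mult[OF df dg])
    then show ?thesis by (simp add: cubic_form_conj[OF dg(2), of "\<lambda>a. log_diff f u a + rlog_diff g u a"])
  qed
  show ?thesis
    unfolding cartan_form_def cg cfg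
  proof (rule has_ext_deriv2I[OF _ cocycle_algebra[OF s(2) t(2) refl refl refl]])
    fix a b
    have "((\<lambda>x. trace (log_diff f x a ** rlog_diff g x b) - trace (log_diff f x b ** rlog_diff g x a))
      has_derivative (\<lambda>h. trace (log_diff f u a ** (t b h - rlog_diff g u b ** rlog_diff g u h)
          + (s a h - log_diff f u h ** log_diff f u a) ** rlog_diff g u b)
       - trace (log_diff f u b ** (t a h - rlog_diff g u a ** rlog_diff g u h)
          + (s b h - log_diff f u h ** log_diff f u b) ** rlog_diff g u a))) (at u)"
      by (intro has_derivative_diff bounded_linear.has_derivative[OF bounded_linear_trace] matrix_mult.FDERIV s(1) t(1))
    then show "((\<lambda>x. cocycle f g x a b) has_derivative
      (\<lambda>h. (trace (log_diff f u a ** (t b h - rlog_diff g u b ** rlog_diff g u h))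
          + trace ((s a h - log_diff f u h ** log_diff f u a) ** rlog_diff g u b))
       - (trace (log_diff f u b ** (t a h - rlog_diff g u a ** rlog_diff g u h))
          + trace ((s b h - log_diff f u h ** log_diff f u b) ** rlog_diff g u a)))) (at u)"
      by (simp only: cocycle_def tr_wedge_def trace_add)
  qed
qed

lemma log_diff_transform:
  assumes "f differentiable (at u)" "open U" "u \<in> U" "\<And>x. x \<in> U \<Longrightarrow> f x = g x"
  shows "log_diff f u = log_diff g u"
  using frechet_derivative_transform_within_open[OF assms] assms(3,4)
  by (simp add: fun_eq_iff log_diff_def)

lemma cartan_form_zero:
  assumes "\<And>a. log_diff f u a = 0"
  shows "cartan_form f u a b c = 0"
  by (simp add: cartan_form_def cubic_form_def assms trace_zero)

text \<open>
In the sum of the three cocycles the 3-forms of \<open>G\<close>, \<open>G L\<close> and \<open>C\<inverse>\<close> cancel, and that of the diagonal \<open>L\<close> is zero. The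
3-forms of \<open>(G L) C\<inverse> = N\<close> and \<open>G C\<inverse> = K\<close> remain.
\<close>

lemma factor_form_ext_deriv:
  fixes C L K :: "'a::real_normed_vector \<Rightarrow> complex^'n^'n"
  assumes U: "open U" "u \<in> U"
    and F: "\<And>x. x \<in> U \<Longrightarrow> monodromy_factor C L K x"
    and diff: "twice_differentiable_on U C" "twice_differentiable_on U L" "twice_differentiable_on U K"
    and comm: "\<And>a b. log_diff L u a ** log_diff L u b = log_diff L u b ** log_diff L u a"
  shows "has_ext_deriv2 (\<lambda>x. monodromy_factor.factor_form C L K x) u
    (\<lambda>a b c. cartan_form (\<lambda>x. K x ** (C x ** L x ** matrix_inv (C x))) u a b c - cartan_form K u a b c)"
proof -
  let ?G = "\<lambda>x. K x ** C x" and ?GL = "\<lambda>x. K x ** C x ** L x" and ?Ci = "\<lambda>x. matrix_inv (C x)"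
  have inv: "invertible (C x)" "invertible (L x)" "invertible (K x)" "invertible (K x ** C x)"
    "invertible (K x ** C x ** L x)" "invertible (matrix_inv (C x))" if "x \<in> U" for x
    using monodromy_factor.inv[OF F[OF that]] monodromy_factor.factor_inv[OF F[OF that]] by simp_all
  have t: "twice_differentiable_on U ?G" "twice_differentiable_on U ?GL" "twice_differentiable_on U ?Ci"
    by (intro twice_differentiable_on_mult twice_differentiable_on_matrix_inv diff inv; assumption)+
  have KG: "cartan_form (\<lambda>x. K x ** C x ** matrix_inv (C x)) u = cartan_form K u"
    unfolding cartan_form_def
    by (subst log_diff_transform[OF twice_differentiable_on_differentiable[OF diff(3) U(2)] U])
      (simp_all add: matrix_mul_assoc[symmetric] matrix_inv_cancel inv)
  have N: "(\<lambda>x. K x ** C x ** L x ** matrix_inv (C x)) = (\<lambda>x. K x ** (C x ** L x ** matrix_inv (C x)))"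
    by (simp add: matrix_mul_assoc)
  have L0: "cartan_form L u a b c = 0" for a b c
    by (simp add: cartan_form_def cubic_form_def comm[of b c] trace_zero)
  have "has_ext_deriv2 (\<lambda>x a b. cocycle ?G ?Ci x a b - cocycle ?GL ?Ci x a b - cocycle ?G L x a b) u
    (\<lambda>a b c. (cartan_form ?G u a b c + cartan_form ?Ci u a b c - cartan_form (\<lambda>x. ?G x ** ?Ci x) u a b c)
       - (cartan_form ?GL u a b c + cartan_form ?Ci u a b c - cartan_form (\<lambda>x. ?GL x ** ?Ci x) u a b c)
       - (cartan_form ?G u a b c + cartan_form L u a b c - cartan_form (\<lambda>x. ?G x ** L x) u a b c))"
    by (intro has_ext_deriv2_diff cocycle_ext_deriv[OF U] t diff inv)
  then have "has_ext_deriv2 (\<lambda>x a b. cocycle ?G ?Ci x a b - cocycle ?GL ?Ci x a b - cocycle ?G L x a b) u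
    (\<lambda>a b c. cartan_form (\<lambda>x. K x ** (C x ** L x ** matrix_inv (C x))) u a b c - cartan_form K u a b c)"
    unfolding KG N L0 by simp
  then show ?thesis
    by (rule has_ext_deriv2_transform[OF _ U]) (simp add: monodromy_factor.factor_form_eq_cocycles[OF F])
qed

context
  fixes U :: "(complex^'d) set" and \<sigma> :: "complex^'d \<Rightarrow> ('n::finite, 'N::{finite,linorder}) mdata"
  assumes chart: "quotient_chart U \<sigma>"
begin

lemma chart_open: "open U"
  and chart_constraint: "u \<in> U \<Longrightarrow> \<sigma> u \<in> constraint_set"
  and chart_twice_differentiable: "twice_differentiable_on U \<sigma>"
  using chart holomorphic_map_twice_differentiable[of U \<sigma>] by (auto simp: quotient_chart_def)

lemma chart_differentiable: "u \<in> U \<Longrightarrow> \<sigma> differentiable (at u)"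
  by (rule twice_differentiable_on_differentiable[OF chart_twice_differentiable])

lemma chart_frames: "u \<in> U \<Longrightarrow> frames_invertible (\<sigma> u)"
  using chart_constraint constraint_set_frames by blast

text \<open>
By the definition of a chart the class of the derivative lies in the tangent space of the quotient; so the derivative
differs from a tangent vector of the constraint set by the tangent group, which preserves tangency.
\<close>

lemma chart_tangent:
  assumes u: "u \<in> U"
  shows "differential \<sigma> u a \<in> constraint_tangent (\<sigma> u)"
proof -
  have "chart_diff \<sigma> u a \<in> tangent_space (gauge_rel `` {\<sigma> u})"
  proof -
    have "range (chart_diff \<sigma> u) = tangent_space (gauge_rel `` {\<sigma> u})"
      using chart u by (simp add: quotient_chart_def bij_betw_imp_surj_on)
    then show ?thesis by blast
  qed
  then obtain q w where q: "dproj (\<sigma> u) (differential \<sigma> u a) = dproj q w"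
    "(\<sigma> u, q) \<in> gauge_rel" "w \<in> constraint_tangent q"
    by (auto simp: tangent_space_def chart_diff_def)
  obtain S X where "S \<in> SL" "X \<in> sl" "\<sigma> u = lmult S q" "differential \<sigma> u a = lmult S w + inf_action X (\<sigma> u)"
    using dproj_eqD[OF q(1)] by blast
  then show ?thesis
    using constraint_tangent_gauge[of q S X w] q chart_constraint[OF u] by (auto simp: gauge_rel_def)
qed

lemma chart_pullback_eq:
  assumes u: "u \<in> U"
  shows "chart_pullback omega_M \<sigma> u a b = 1 / (4 * of_real pi * \<i>) * (\<Sum>j\<in>UNIV.
     monodromy_factor.factor_form (\<lambda>u. Cmat j (\<sigma> u)) (\<lambda>u. Lam j (\<sigma> u)) (\<lambda>u. partial_prod {..<j} (\<sigma> u)) u a b)"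
proof -
  have "chart_pullback omega_M \<sigma> u a b = omega (\<sigma> u) (differential \<sigma> u a) (differential \<sigma> u b)"
    unfolding chart_pullback_def chart_diff_def
    using descends_to_omega_M chart_constraint[OF u] chart_tangent[OF u] unfolding descends_to_def by blast
  then show ?thesis
    unfolding omega_eq_factor_forms[OF chart_frames[OF u]]
      factor_form_pullback[OF chart_differentiable[OF u] chart_frames[OF u]] .
qed

lemma chart_twice_differentiable_Cmat: "twice_differentiable_on U (\<lambda>u. Cmat j (\<sigma> u))"
  by (rule twice_differentiable_on_linear[OF bounded_linear_Cmat chart_twice_differentiable])

lemma chart_twice_differentiable_Lam: "twice_differentiable_on U (\<lambda>u. Lam j (\<sigma> u))"
  unfolding Lam_eq
  by (rule twice_differentiable_on_exp_diag[OF
     twice_differentiable_on_linear[OF bounded_linear_exponents chart_twice_differentiable]])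

lemma chart_twice_differentiable_partial_prod:
  "twice_differentiable_on U (\<lambda>u. partial_prod T (\<sigma> u))"
  using finite[of T]
proof (induction T rule: finite_linorder_max_induct)
  case empty
  show ?case
    by (rule twice_differentiable_onI[where f' = "\<lambda>u a. 0" and f'' = "\<lambda>u a b. 0"]) simp_all
next
  case (insert b T)
  have "(\<lambda>u. partial_prod (insert b T) (\<sigma> u)) = (\<lambda>u. partial_prod T (\<sigma> u) **
     (Cmat b (\<sigma> u) ** Lam b (\<sigma> u) ** matrix_inv (Cmat b (\<sigma> u))))"
    using insert.hyps by (auto simp: fun_eq_iff partial_prod_insert Mmat_def)
  then show ?case
    using insert.IH chart_frames
    by (auto intro!: twice_differentiable_on_mult twice_differentiable_on_matrix_inv
        chart_twice_differentiable_Cmat chart_twice_differentiable_Lam simp: frames_invertible_def)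
qed

text \<open>
The exterior derivative telescopes to the difference of the 3-forms of the full and of the empty product.
Both products are constant along the chart.
\<close>

lemma chart_pullback_closed:
  assumes u: "u \<in> U"
  shows "has_ext_deriv2 (chart_pullback omega_M \<sigma>) u (\<lambda>a b c. 0)"
proof -
  let ?C = "\<lambda>j u. Cmat j (\<sigma> u)" and ?L = "\<lambda>j u. Lam j (\<sigma> u)" and ?P = "\<lambda>S u. partial_prod S (\<sigma> u)"
  let ?k = "1 / (4 * of_real pi * \<i>) :: complex"
  have comm: "log_diff (?L j) u a ** log_diff (?L j) u b = log_diff (?L j) u b ** log_diff (?L j) u a" for j a b
    unfolding log_diff_compose[OF chart_differentiable[OF u] Lam_differentiable] log_diff_Lam Lmat_def msmult_diag_mat
    by (rule diag_mat_commute)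
  have fact: "monodromy_factor (?C j) (?L j) (?P {..<j}) x" if "x \<in> U" for j x
    by (rule monodromy_factor_pullback[OF chart_differentiable[OF that] chart_frames[OF that]])
  have "has_ext_deriv2 (\<lambda>x. monodromy_factor.factor_form (?C j) (?L j) (?P {..<j}) x) u
    (\<lambda>a b c. cartan_form (?P {..j}) u a b c - cartan_form (?P {..<j}) u a b c)" for j
    using factor_form_ext_deriv[OF chart_open u fact chart_twice_differentiable_Cmat
      chart_twice_differentiable_Lam chart_twice_differentiable_partial_prod comm, of j]
    by (simp add: partial_prod_atMost_fun)
  from has_ext_deriv2_cmult_sum[of UNIV, OF this]
  have "has_ext_deriv2 (\<lambda>x a b. ?k * (\<Sum>j\<in>UNIV. monodromy_factor.factor_form (?C j) (?L j) (?P {..<j}) x a b)) u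
    (\<lambda>a b c. ?k * (\<Sum>j\<in>UNIV. cartan_form (?P {..j}) u a b c - cartan_form (?P {..<j}) u a b c))" .
  moreover have "(\<Sum>j\<in>UNIV. cartan_form (?P {..j}) u a b c - cartan_form (?P {..<j}) u a b c) = 0" for a b c
  proof -
    have "log_diff (?P UNIV) u a = 0" for a
      unfolding log_diff_compose[OF chart_differentiable[OF u] partial_prod_differentiable[OF chart_frames[OF u]]]
      using chart_tangent[OF u, of a] by (simp add: log_diff_def constraint_tangent_def total_eq)
    moreover have "log_diff (?P {}) u a = 0" for a
      by (simp add: log_diff_def)
    ultimately show ?thesis
      using sum_telescope_linorder[of UNIV "\<lambda>S. cartan_form (?P S) u a b c"] by (simp add: cartan_form_zero)
  qed
  ultimately have "has_ext_deriv2 (\<lambda>x a b. ?k * (\<Sum>j\<in>UNIV.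
     monodromy_factor.factor_form (?C j) (?L j) (?P {..<j}) x a b)) u (\<lambda>a b c. 0)"
    by simp
  then show ?thesis
    by (rule has_ext_deriv2_transform[OF _ chart_open u]) (simp add: chart_pullback_eq)
qed

end

lemma closed_omega_M: "closed_form TYPE('d::finite) (omega_M :: ('n::finite, 'N::{finite,linorder}) mform)"
  unfolding closed_form_def using has_ext_deriv2_imp[OF chart_pullback_closed] by blast

theorem corollary3p1:
  shows "descends_to omega (omega_M :: ('n::finite, 'N::{finite,linorder}) mform)
    \<and> closed_form TYPE('d::finite) (omega_M :: ('n, 'N) mform)
    \<and> nondegenerate_form (omega_M :: ('n, 'N) mform)"
  by (intro conjI descends_to_omega_M closed_omega_M nondegenerate_omega_M)

end
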